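(* Let $G$ be an $n$-vertex eulerian graph such that $\delta(G_{\mathrm{s}})\ge (4n+2)/5$, where $\delta(G_{\mathrm{s}})$ is the minimum degree of the underlying simple graph $G_{\mathrm{s}}$ of $G$. Let $\mathcal{C}$ be a circuit decomposition of $G$. Then there is a $2$-face-colorable orientable embedding of $G$ with the elements of $\mathcal{C}$ as one of the color classes and with exactly one or two faces of the other color, depending on whether $|V(G)|+|E(G)|+|\mathcal{C}|$ is odd or even, respectively. This embedding has maximum genus among all orientable embeddings of $G$ in which all elements of $\mathcal{C}$ are faces.
   Context: Graphs are finite and may have loops and multiple edges. An eulerian graph is a connected graph with every vertex of even degree. $G_{\mathrm{s}}$ is the simple graph on $V(G)$ in which distinct $u,v$ are adjacent if and only if they are joined by an edge of $G$. A circuit is a closed walk with no repeated edge (vertices may repeat) and at least one edge, considered up to cyclic shift (and, as a facial walk, up to reversal). A circuit decomposition of $G$ is a collection of circuits that together use every edge of $G$ exactly once. All embeddings are cellular embeddings in closed surfaces; a face is identified with its facial boundary walk. An embedding is $2$-face-colorable if its faces can be colored with two colors so that each edge has faces of different colors on its two sides. *)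

theory Defs
  imports
    Complex_Main
    "HOL-Combinatorics.Cycles"
    "HOL-Combinatorics.Orbits"
    "Graph_Theory.Graph_Theory"
    "Graph_Theory.Bidirected_Digraph"
begin

text \<open>
  A finite graph, possibly with loops and multiple edges, is a finite bidirected multi-digraph
  \<open>G\<close> whose arcs are the two directed traversals of the edges; \<open>rv\<close> maps an arc to the
  opposite traversal of the same edge.  A loop also has two distinct arcs, so \<open>out_degree\<close>
  is the graph degree, with loops counted twice.
\<close>

definition multigraph :: "('v, 'e) pre_digraph \<Rightarrow> ('e \<Rightarrow> 'e) \<Rightarrow> bool" where
  "multigraph G rv \<longleftrightarrow> fin_digraph G \<and> bidirected_digraph G rv"

definition edges :: "('v, 'e) pre_digraph \<Rightarrow> ('e \<Rightarrow> 'e) \<Rightarrow> 'e set set" where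
  "edges G rv = (\<lambda>a. {a, rv a}) ` arcs G"

definition eulerian :: "('v, 'e) pre_digraph \<Rightarrow> bool" where
  "eulerian G \<longleftrightarrow> connected G \<and> (\<forall>v \<in> verts G. even (out_degree G v))"

definition underlying_simple :: "('v, 'e) pre_digraph \<Rightarrow> ('v, 'v \<times> 'v) pre_digraph" where
  "underlying_simple G =
     \<lparr>verts = verts G, arcs = {(u, v) \<in> arcs_ends G. u \<noteq> v}, tail = fst, head = snd\<rparr>"

definition min_degree :: "('v, 'e) pre_digraph \<Rightarrow> nat" where
  "min_degree G = Min (out_degree G ` verts G)"


subsection \<open>Circuits\<close>

text \<open>
  A closed walk is given by a list of arcs, and is considered up to cyclic shift and reversal by
  passing to the set of all its representatives.
\<close>

definition reverse_walk :: "('e \<Rightarrow> 'e) \<Rightarrow> 'e list \<Rightarrow> 'e list" where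
  "reverse_walk rv w = rev (map rv w)"

definition walk_class :: "('e \<Rightarrow> 'e) \<Rightarrow> 'e list \<Rightarrow> 'e list set" where
  "walk_class rv w = (\<Union>i. {rotate i w, rotate i (reverse_walk rv w)})"

definition circuit_walk :: "('v, 'e) pre_digraph \<Rightarrow> ('e \<Rightarrow> 'e) \<Rightarrow> 'e list \<Rightarrow> bool" where
  "circuit_walk G rv w \<longleftrightarrow>
     w \<noteq> [] \<and> (\<exists>u. pre_digraph.awalk G u w u) \<and> distinct w \<and> (\<forall>a \<in> set w. rv a \<notin> set w)"

definition circuits :: "('v, 'e) pre_digraph \<Rightarrow> ('e \<Rightarrow> 'e) \<Rightarrow> 'e list set set" where
  "circuits G rv = walk_class rv ` {w. circuit_walk G rv w}"

text \<open>
  Walk classes are closed under reversal, so an edge lies on a circuit iff each of its two arcs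
  occurs in some representative.
\<close>

definition circuit_decomposition ::
    "('v, 'e) pre_digraph \<Rightarrow> ('e \<Rightarrow> 'e) \<Rightarrow> 'e list set set \<Rightarrow> bool" where
  "circuit_decomposition G rv C \<longleftrightarrow>
     C \<subseteq> circuits G rv \<and> (\<forall>a \<in> arcs G. \<exists>!c. c \<in> C \<and> (\<exists>w \<in> c. a \<in> set w))"


subsection \<open>Orientable embeddings\<close>

text \<open>
  A cellular embedding of a connected graph in a closed orientable surface is represented by its
  rotation system \<open>s\<close> (Heffter--Edmonds): \<open>s\<close> cyclically permutes the arcs leaving each vertex.
\<close>

definition orientable_embedding :: "('v, 'e) pre_digraph \<Rightarrow> ('e \<Rightarrow> 'e) \<Rightarrow> bool" where
  "orientable_embedding G s \<longleftrightarrow>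
     s permutes arcs G \<and>
     (\<forall>v \<in> verts G. out_arcs G v \<noteq> {} \<longrightarrow> cyclic_on s (out_arcs G v))"

text \<open>
  Face tracing: after arriving along \<open>a\<close>, a facial walk leaves along the arc that follows
  \<open>rv a\<close> in the rotation.  Faces are the orbits of this map, and the two sides of
  an edge belong to the faces of its two arcs.
\<close>

definition face_succ :: "('e \<Rightarrow> 'e) \<Rightarrow> ('e \<Rightarrow> 'e) \<Rightarrow> 'e \<Rightarrow> 'e" where
  "face_succ rv s = s \<circ> rv"

definition face_of :: "('e \<Rightarrow> 'e) \<Rightarrow> ('e \<Rightarrow> 'e) \<Rightarrow> 'e \<Rightarrow> 'e set" where
  "face_of rv s a = orbit (face_succ rv s) a"

definition faces :: "('v, 'e) pre_digraph \<Rightarrow> ('e \<Rightarrow> 'e) \<Rightarrow> ('e \<Rightarrow> 'e) \<Rightarrow> 'e set set" where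
  "faces G rv s = face_of rv s ` arcs G"

text \<open>
  \<open>support (face_succ rv s) a\<close> lists the face of \<open>a\<close> in facial order, starting at \<open>a\<close>; all
  starting points in the face give the same class.
\<close>

definition boundary_walk :: "('e \<Rightarrow> 'e) \<Rightarrow> ('e \<Rightarrow> 'e) \<Rightarrow> 'e set \<Rightarrow> 'e list set" where
  "boundary_walk rv s F = (\<Union>a \<in> F. walk_class rv (support (face_succ rv s) a))"

text \<open>\<open>X\<close> is one color class of a proper coloring of the faces with two colors.\<close>

definition face_color_class ::
    "('v, 'e) pre_digraph \<Rightarrow> ('e \<Rightarrow> 'e) \<Rightarrow> ('e \<Rightarrow> 'e) \<Rightarrow> 'e set set \<Rightarrow> bool" where
  "face_color_class G rv s X \<longleftrightarrow>
     X \<subseteq> faces G rv s \<and>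
     (\<forall>a \<in> arcs G. (face_of rv s a \<in> X) \<noteq> (face_of rv s (rv a) \<in> X))"

text \<open>
  For a connected graph with at least one edge, Euler's formula \<open>|V| - |E| + |F| = 2 - 2g\<close>.
\<close>

definition genus :: "('v, 'e) pre_digraph \<Rightarrow> ('e \<Rightarrow> 'e) \<Rightarrow> ('e \<Rightarrow> 'e) \<Rightarrow> real" where
  "genus G rv s =
     (2 - (real (card (verts G)) - real (card (edges G rv)) + real (card (faces G rv s)))) / 2"

end

theory Submission
  imports Defs "HOL-Library.Multiset" "HOL-Library.Sublist"
begin

text \<open>
  Orient every circuit of \<open>C\<close>. Since the circuits are to be faces, the rotation at a vertex \<open>v\<close> is
  determined by a cyclic permutation of the arcs that enter \<open>v\<close> in this orientation; if \<open>t\<close> joins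
  these permutations and \<open>nxt\<close> is the successor along the circuits, the remaining faces are the
  cycles of \<open>nxt \<circ> t\<close>. For three arcs \<open>a, b, c\<close> entering the same vertex, one of
  \<open>t \<circ> (a b c)\<close> and \<open>t \<circ> (a c b)\<close> is again admissible. This merges three cycles that meet at a
  vertex, transfers a segment from one cycle to another, or reorders or splits a cycle into three.

  Take a choice with the minimal number of cycles, and suppose that this is at least three; take
  among these choices one with a longest cycle \<open>F\<close>. No vertex lies on three cycles, and a vertex of
  \<open>F\<close> occurs at most once on any other cycle. One finds vertices \<open>v\<close>, \<open>w\<close> on \<open>F\<close> which lie on two
  different further cycles; they are not interlaced on \<open>F\<close>, since otherwise a transfer at \<open>v\<close> would
  put \<open>w\<close> on three cycles. A vertex occurring on \<open>F\<close> between occurrences of \<open>v\<close>, between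
  occurrences of \<open>w\<close>, and in a third place, would allow a split or a reordering after which the
  number of cycles can be lowered. Hence each vertex visiting both sides is confined to one gap of
  \<open>v\<close> and one gap of \<open>w\<close>, and is adjacent to few vertices of the same kind, while by density almost
  every vertex is of this kind: this contradicts the degree bound. The parity of the number of
  faces decides between one and two, and yields maximality of the genus.
\<close>

section \<open>Cyclic words\<close>

lemma subseq_Cons_iff: "subseq (x # xs) ys \<longleftrightarrow> (\<exists>a b. ys = a @ x # b \<and> subseq xs b)"
proof
  assume "subseq (x # xs) ys"
  then show "\<exists>a b. ys = a @ x # b \<and> subseq xs b"
    using list_emb_ConsD by fastforce
next
  assume "\<exists>a b. ys = a @ x # b \<and> subseq xs b"
  then show "subseq (x # xs) ys"
    by (auto intro: list_emb_append2 subseq_Cons2)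
qed

lemma subseq_singleton_iff: "subseq [x] ys \<longleftrightarrow> x \<in> set ys"
  by (simp add: subseq_singleton_left)

definition consec :: "'a list \<Rightarrow> 'a \<Rightarrow> 'a \<Rightarrow> bool" where
  "consec xs x y \<longleftrightarrow> (\<exists>A B. xs = A @ x # y # B)"

definition cconsec :: "'a list \<Rightarrow> 'a \<Rightarrow> 'a \<Rightarrow> bool" where
  "cconsec xs x y \<longleftrightarrow> consec xs x y \<or> (xs \<noteq> [] \<and> last xs = x \<and> hd xs = y)"

lemma consec_append:
  "consec (P @ Q) x y \<longleftrightarrow>
     consec P x y \<or> consec Q x y \<or> (P \<noteq> [] \<and> Q \<noteq> [] \<and> last P = x \<and> hd Q = y)"
proof
  assume "consec (P @ Q) x y"
  then obtain A B where "P @ Q = A @ x # y # B" by (auto simp: consec_def)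
  then obtain us where "(P = A @ us \<and> us @ Q = x # y # B) \<or> (P @ us = A \<and> Q = us @ x # y # B)"
    by (auto simp: append_eq_append_conv2)
  then show "consec P x y \<or> consec Q x y \<or> (P \<noteq> [] \<and> Q \<noteq> [] \<and> last P = x \<and> hd Q = y)"
  proof
    assume a: "P = A @ us \<and> us @ Q = x # y # B"
    show ?thesis
    proof (cases us)
      case Nil
      then show ?thesis using a by (auto simp: consec_def intro: exI[of _ "[]"])
    next
      case (Cons u us')
      then show ?thesis using a by (cases us') (auto simp: consec_def)
    qed
  qed (auto simp: consec_def)
next
  assume "consec P x y \<or> consec Q x y \<or> (P \<noteq> [] \<and> Q \<noteq> [] \<and> last P = x \<and> hd Q = y)"
  then consider "consec P x y" | "consec Q x y" | "P \<noteq> [] \<and> Q \<noteq> [] \<and> last P = x \<and> hd Q = y"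
    by blast
  then show "consec (P @ Q) x y"
  proof cases
    case 1
    then obtain A B where "P = A @ x # y # B" by (auto simp: consec_def)
    then have "P @ Q = A @ x # y # (B @ Q)" by simp
    then show ?thesis unfolding consec_def by blast
  next
    case 2
    then obtain A B where "Q = A @ x # y # B" by (auto simp: consec_def)
    then have "P @ Q = (P @ A) @ x # y # B" by simp
    then show ?thesis unfolding consec_def by blast
  next
    case 3
    then have "P @ Q = butlast P @ x # y # tl Q"
      by (metis append.assoc append_Cons append_Nil append_butlast_last_id list.collapse)
    then show ?thesis unfolding consec_def by blast
  qed
qed

lemma consec_in_set: "consec xs x y \<Longrightarrow> x \<in> set xs \<and> y \<in> set xs"
  by (auto simp: consec_def)

lemma cconsec_in_set: "cconsec xs x y \<Longrightarrow> x \<in> set xs \<and> y \<in> set xs"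
  by (auto simp: cconsec_def dest: consec_in_set)

lemma cconsec_append:
  assumes "P \<noteq> []" "Q \<noteq> []"
  shows "cconsec (P @ Q) x y \<longleftrightarrow>
    consec P x y \<or> consec Q x y \<or> (last P = x \<and> hd Q = y) \<or> (last Q = x \<and> hd P = y)"
  using assms by (auto simp: cconsec_def consec_append)

text \<open>A word containing v only once is rotated so that it ends in v. The cyclic neighbours of
  v are then just the first letter and \<open>last G\<close>, so at most two neighbours of v are met
  along that word.\<close>

lemma consec_snoc_fresh:
  assumes "v \<notin> set G"
  shows "consec (G @ [v]) x v \<Longrightarrow> x = last G" "\<not> consec (G @ [v]) v x"
proof -
  have 1: "\<not> consec G x v" "\<not> consec G v x" for x
    using assms by (auto dest: consec_in_set)
  have 2: "\<not> consec [v] y z" for y z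
    by (auto simp: consec_def Cons_eq_append_conv)
  show "consec (G @ [v]) x v \<Longrightarrow> x = last G" using 1 2 by (auto simp: consec_append)
  show "\<not> consec (G @ [v]) v x" using 1 2 assms by (auto simp: consec_append)
qed

text \<open>Only the first occurrence of \<open>x\<close> counts here; \<open>gap_label\<close> is used for vertices all of whose
  occurrences lie in the same gap of \<open>v\<close>.\<close>

definition gap_label :: "'a \<Rightarrow> 'a list \<Rightarrow> 'a \<Rightarrow> nat" where
  "gap_label v P x = count_list (takeWhile (\<lambda>y. y \<noteq> x) P) v"

text \<open>\<open>inner_nbr v P x c\<close>: some occurrence of \<open>x\<close> in \<open>P\<close> is next to an occurrence of \<open>v\<close>, and
  lies between the \<open>c\<close>-th and the \<open>(c+1)\<close>-st occurrence of \<open>v\<close> (if \<open>P\<close> starts with \<open>v\<close>).\<close>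

definition inner_nbr :: "'a \<Rightarrow> 'a list \<Rightarrow> 'a \<Rightarrow> nat \<Rightarrow> bool" where
  "inner_nbr v P x c \<longleftrightarrow>
     (\<exists>A B. P = A @ v # x # B \<and> c = Suc (count_list A v) \<and> v \<in> set B) \<or>
     (\<exists>A B. P = A @ x # v # B \<and> c = count_list A v)"

text \<open>A second occurrence of x beyond a further v would complete the pattern v, x, v, x, the
  leading v coming from \<open>hd P = v\<close>. So all occurrences lie in one gap, and the first
  one can represent them.\<close>

lemma gap_label_eq:
  assumes "\<not> subseq [v, x, v, x] P" "hd P = v" "x \<noteq> v" "P = A @ x # B"
  shows "count_list A v = gap_label v P x"
proof -
  obtain A1 B1 where *: "P = A1 @ x # B1" "x \<notin> set A1"
    using split_list_first[of x P] assms(4) by auto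
  have l: "gap_label v P x = count_list A1 v"
    unfolding gap_label_def * using *(2) by (subst takeWhile_append2) auto
  have "A1 @ x # B1 = A @ x # B" using * assms by simp
  then obtain C where "(A1 = A @ C \<and> C @ x # B1 = x # B) \<or> (A1 @ C = A \<and> x # B1 = C @ x # B)"
    unfolding append_eq_append_conv2 by blast
  then show ?thesis
  proof
    assume "A1 = A @ C \<and> C @ x # B1 = x # B"
    then show ?thesis using *(2) l by (cases C) auto
  next
    assume a: "A1 @ C = A \<and> x # B1 = C @ x # B"
    have hdA: "v \<in> set A1" using * assms(2,3) by (cases A1) auto
    have "v \<notin> set C"
    proof
      assume "v \<in> set C"
      then obtain C1 C2 where "C = C1 @ v # C2" by (auto simp: in_set_conv_decomp)
      moreover have "hd (C @ x # B) = x" using a by (metis list.sel(1))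
      ultimately have "C1 \<noteq> []" "hd C1 = x" using assms(3) by (cases C1; auto)+
      then obtain C3 where "C = x # C3 @ v # C2" using \<open>C = C1 @ v # C2\<close> by (cases C1) auto
      obtain E1 E2 where "A1 = E1 @ v # E2" using hdA by (auto simp: in_set_conv_decomp)
      have "P = E1 @ v # (E2 @ x # (C3 @ v # (C2 @ x # B)))"
        using assms(4) a \<open>A1 = _\<close> \<open>C = x # _\<close> by auto
      then have "subseq [v, x, v, x] P" unfolding subseq_Cons_iff by blast
      then show False using assms(1) by simp
    qed
    then show ?thesis using l a by (auto simp: count_list_append)
  qed
qed

lemma count_list_split_unique:
  assumes "A @ v # B = A' @ v # B'" "count_list A v = count_list A' v"
  shows "A = A' \<and> B = B'"
proof -
  obtain C where "(A = A' @ C \<and> C @ v # B = v # B') \<or> (A @ C = A' \<and> v # B = C @ v # B')"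
    using assms(1) unfolding append_eq_append_conv2 by blast
  then show ?thesis using assms(2)
    by (cases C) (auto simp: count_list_append)
qed

text \<open>A gap has one position right after its opening v and one right before its closing v, and
  counting the earlier v's pins each of them down.\<close>

lemma inner_nbr_card: "finite {x. inner_nbr v P x c \<and> x \<noteq> v}" "card {x. inner_nbr v P x c \<and> x \<noteq> v} \<le> 2"
proof -
  let ?S1 = "{x. x \<noteq> v \<and> (\<exists>A B. P = A @ v # x # B \<and> c = Suc (count_list A v))}"
  let ?S2 = "{x. x \<noteq> v \<and> (\<exists>A B. P = A @ x # v # B \<and> c = count_list A v)}"
  have "x = y" if xy: "x \<in> ?S1" "y \<in> ?S1" for x y
  proof -
    obtain A B A' B' where "P = A @ v # x # B" "c = Suc (count_list A v)"
       "P = A' @ v # y # B'" "c = Suc (count_list A' v)" using xy by blast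
    then show ?thesis using count_list_split_unique[of A v "x # B" A' "y # B'"] by simp
  qed
  then obtain s1 where s1: "?S1 \<subseteq> {s1}" by blast
  have "x = y" if xy: "x \<in> ?S2" "y \<in> ?S2" for x y
  proof -
    obtain A B A' B' where "P = A @ x # v # B" "c = (count_list A v)"
       "P = A' @ y # v # B'" "c = (count_list A' v)" using xy by blast
    then show ?thesis
      using count_list_split_unique[of "A @ [x]" v "B" "A' @ [y]" "B'"] xy by (simp add: count_list_append)
  qed
  then obtain s2 where s2: "?S2 \<subseteq> {s2}" by blast
  have "{x. inner_nbr v P x c \<and> x \<noteq> v} \<subseteq> ?S1 \<union> ?S2" unfolding inner_nbr_def by blast
  then have sub: "{x. inner_nbr v P x c \<and> x \<noteq> v} \<subseteq> {s1, s2}" using s1 s2 by blast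
  then show "finite {x. inner_nbr v P x c \<and> x \<noteq> v}" by (rule finite_subset) simp
  have "card {x. inner_nbr v P x c \<and> x \<noteq> v} \<le> card {s1, s2}" using sub by (intro card_mono) auto
  also have "\<dots> \<le> 2" by (simp add: card_insert_if)
  finally show "card {x. inner_nbr v P x c \<and> x \<noteq> v} \<le> 2" .
qed

lemma inner_nbr_label:
  assumes "\<not> subseq [v, x, v, x] P" "hd P = v" "x \<noteq> v" "inner_nbr v P x c"
  shows "c = gap_label v P x"
  using assms(4) unfolding inner_nbr_def
proof
  assume "\<exists>A B. P = A @ v # x # B \<and> c = Suc (count_list A v) \<and> v \<in> set B"
  then obtain A B where "P = (A @ [v]) @ x # B" "c = Suc (count_list A v)" by auto
  then show ?thesis using gap_label_eq[OF assms(1-3), of "A @ [v]" B] by (simp add: count_list_append)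
next
  assume "\<exists>A B. P = A @ x # v # B \<and> c = count_list A v"
  then show ?thesis using gap_label_eq[OF assms(1-3)] by blast
qed

lemma inner_nbr_subseq:
  assumes "hd P = v" "x \<noteq> v" "inner_nbr v P x c"
  shows "subseq [v, x, v] P"
  using assms(3) unfolding inner_nbr_def
proof
  assume "\<exists>A B. P = A @ v # x # B \<and> c = Suc (count_list A v) \<and> v \<in> set B"
  then obtain A B where "P = A @ v # ([] @ x # B)" "v \<in> set B" by auto
  then show ?thesis unfolding subseq_Cons_iff[of v] subseq_Cons_iff[of x] subseq_singleton_iff
    by blast
next
  assume "\<exists>A B. P = A @ x # v # B \<and> c = count_list A v"
  then obtain A B where P: "P = A @ x # v # B" by auto
  then obtain A' where "A = v # A'" using assms(1,2) by (cases A) auto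
  then have "P = [] @ v # (A' @ x # ([] @ v # B))" using P by simp
  then show ?thesis unfolding subseq_Cons_iff by blast
qed

text \<open>No v stands between consecutive letters that differ from v, so both lie in one gap. This
  turns adjacency along a word into equality of labels.\<close>

lemma consec_same_label:
  assumes "\<not> subseq [v, x, v, x] P" "\<not> subseq [v, y, v, y] P" "hd P = v" "x \<noteq> v" "y \<noteq> v"
    "consec P x y"
  shows "gap_label v P x = gap_label v P y"
proof -
  obtain A B where P: "P = A @ x # y # B" using assms(6) by (auto simp: consec_def)
  have "count_list A v = gap_label v P x" using gap_label_eq[OF assms(1,3,4) P] .
  moreover have "count_list (A @ [x]) v = gap_label v P y"
    using gap_label_eq[OF assms(2,3,5), of "A @ [x]" B] P by simp
  ultimately show ?thesis using assms(4) by (simp add: count_list_append)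
qed

section \<open>Systems of closed words\<close>

text \<open>Letters are heads of arcs, so a segment is cut right after an arc entering u; the
  3-cycles act exactly on these final arcs.\<close>

definition ends_at :: "'a \<Rightarrow> 'a list \<Rightarrow> bool" where
  "ends_at u X \<longleftrightarrow> X \<noteq> [] \<and> last X = u"

lemma ends_at_snoc: "ends_at u (X @ [u])"
  by (simp add: ends_at_def)

text \<open>
  The members of \<open>D\<close> are the families of cyclic words that arise by writing down, for an admissible
  choice, the heads of the arcs along each cycle; neither the order of the words nor their starting
  points matter. Multiplication with a 3-cycle of arcs entering \<open>u\<close> acts on the words as in
  \<open>merge\<close>, \<open>transfer\<close> and \<open>split\<close>; which of the two outcomes occurs cannot be chosen.
\<close>

locale word_system =
  fixes D :: "'v list list set" and V :: "'v set" and adj :: "'v \<Rightarrow> 'v \<Rightarrow> bool"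
    and N m :: nat
  assumes nonempty: "D \<noteq> {}"
    and word_nonempty: "Ls \<in> D \<Longrightarrow> [] \<notin> set Ls"
    and word_verts: "Ls \<in> D \<Longrightarrow> xs \<in> set Ls \<Longrightarrow> set xs \<subseteq> V"
    and total_length: "Ls \<in> D \<Longrightarrow> length (concat Ls) = m"
    and permute: "Ls \<in> D \<Longrightarrow> mset Ls = mset Ls' \<Longrightarrow> Ls' \<in> D"
    and rotate: "(xs @ ys) # R \<in> D \<Longrightarrow> (ys @ xs) # R \<in> D"
    and merge: "X # Y # Z # R \<in> D \<Longrightarrow> ends_at u X \<Longrightarrow> ends_at u Y \<Longrightarrow> ends_at u Z \<Longrightarrow>
      (X @ Y @ Z) # R \<in> D \<or> (X @ Z @ Y) # R \<in> D"
    and transfer: "(X @ Y) # W # R \<in> D \<Longrightarrow> ends_at u X \<Longrightarrow> ends_at u Y \<Longrightarrow> ends_at u W \<Longrightarrow>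
      X # (Y @ W) # R \<in> D \<or> Y # (X @ W) # R \<in> D"
    and split: "(X @ Y @ Z) # R \<in> D \<Longrightarrow> ends_at u X \<Longrightarrow> ends_at u Y \<Longrightarrow> ends_at u Z \<Longrightarrow>
      (X @ Z @ Y) # R \<in> D \<or> X # Y # Z # R \<in> D"
    and adj_word: "adj x y \<Longrightarrow> Ls \<in> D \<Longrightarrow> \<exists>xs \<in> set Ls. cconsec xs x y \<or> cconsec xs y x"
    and adj_sym: "adj x y \<Longrightarrow> adj y x"
    and finite_V: "finite V"
    and dense: "x \<in> V \<Longrightarrow> card {y \<in> V. y \<noteq> x \<and> \<not> adj x y} \<le> N"
    and large: "5 * N + 7 \<le> card V"
begin

lemma swap12: "X # Y # R \<in> D \<Longrightarrow> Y # X # R \<in> D"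
  by (erule permute) simp

lemma swap23: "X # Y # Z # R \<in> D \<Longrightarrow> X # Z # Y # R \<in> D"
  by (erule permute) simp

lemma rotate_to_end:
  assumes "X # R \<in> D" "u \<in> set X"
  obtains X' where "(X' @ [u]) # R \<in> D" "mset (X' @ [u]) = mset X"
proof -
  obtain A B where "X = A @ u # B" using assms(2) by (auto simp: in_set_conv_decomp)
  then have "((A @ [u]) @ B) # R \<in> D" using assms(1) by simp
  from rotate[OF this] have "((B @ A) @ [u]) # R \<in> D" by simp
  moreover have "mset ((B @ A) @ [u]) = mset X" using \<open>X = _\<close> by simp
  ultimately show thesis using that by blast
qed

lemma rotate_to_end2:
  assumes "A # X # R \<in> D" "u \<in> set X"
  obtains X' where "A # (X' @ [u]) # R \<in> D" "mset (X' @ [u]) = mset X"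
proof -
  obtain X' where "(X' @ [u]) # A # R \<in> D" "mset (X' @ [u]) = mset X"
    using rotate_to_end[OF swap12[OF assms(1)] assms(2)] by blast
  then show thesis using that swap12 by blast
qed

lemma rotate_to_end3:
  assumes "A # B # X # R \<in> D" "u \<in> set X"
  obtains X' where "A # B # (X' @ [u]) # R \<in> D" "mset (X' @ [u]) = mset X"
proof -
  obtain X' where "A # (X' @ [u]) # B # R \<in> D" "mset (X' @ [u]) = mset X"
    using rotate_to_end2[OF swap23[OF assms(1)] assms(2)] by blast
  then show thesis using that swap23 by blast
qed

lemma merge3:
  assumes "X # Y # Z # R \<in> D" "u \<in> set X" "u \<in> set Y" "u \<in> set Z"
  obtains M where "M # R \<in> D" "set M = set X \<union> set Y \<union> set Z"
proof -
  obtain X' where X': "(X' @ [u]) # Y # Z # R \<in> D" "mset (X' @ [u]) = mset X"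
    using rotate_to_end[OF assms(1,2)] by blast
  obtain Y' where Y': "(X' @ [u]) # (Y' @ [u]) # Z # R \<in> D" "mset (Y' @ [u]) = mset Y"
    using rotate_to_end2[OF X'(1) assms(3)] by blast
  obtain Z' where Z': "(X' @ [u]) # (Y' @ [u]) # (Z' @ [u]) # R \<in> D" "mset (Z' @ [u]) = mset Z"
    using rotate_to_end3[OF Y'(1) assms(4)] by blast
  have s: "set (X' @ [u]) = set X" "set (Y' @ [u]) = set Y" "set (Z' @ [u]) = set Z"
    using X'(2) Y'(2) Z'(2) by (metis set_mset_mset)+
  show thesis
    using merge[OF Z'(1) ends_at_snoc ends_at_snoc ends_at_snoc]
  proof
    assume "((X' @ [u]) @ (Y' @ [u]) @ (Z' @ [u])) # R \<in> D"
    from this show thesis by (rule that) (use s in \<open>auto simp del: append_assoc\<close>)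
  next
    assume "((X' @ [u]) @ (Z' @ [u]) @ (Y' @ [u])) # R \<in> D"
    from this show thesis by (rule that) (use s in \<open>auto simp del: append_assoc\<close>)
  qed
qed

end

text \<open>The number k is the supposed least number of words. Minimality is used through surgeries
  that would leave fewer than k words.\<close>

locale min_word_system = word_system D V adj N m
  for D :: "'v list list set" and V :: "'v set" and adj :: "'v \<Rightarrow> 'v \<Rightarrow> bool" and N m :: nat +
  fixes k :: nat
  assumes minimal: "Ls \<in> D \<Longrightarrow> k \<le> length Ls"
    and k_ge: "3 \<le> k"
begin

lemma no_three_words:
  assumes "X # Y # Z # R \<in> D" "length (X # Y # Z # R) = k"
    "u \<in> set X" "u \<in> set Y" "u \<in> set Z"
  shows False
proof -
  obtain M where "M # R \<in> D" using merge3[OF assms(1,3-5)] by blast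
  then show False using minimal[of "M # R"] assms(2) by simp
qed

text \<open>Cut F at two occurrences of v so that both segments contain w. Whichever segment
  \<open>transfer\<close> moves to G, the other one, the enlarged G and H all contain w, against
  \<open>no_three_words\<close>.\<close>

lemma no_interlace:
  assumes "F # G # H # R \<in> D" "length (F # G # H # R) = k"
    and v: "v \<in> set G" and w: "w \<in> set H" and s: "subseq [v, w, v, w] F"
  shows False
proof -
  obtain a b c d e where F: "F = a @ v # b @ w # c @ v # d @ w # e"
    using s unfolding subseq_Cons_iff by blast
  let ?X = "b @ w # c @ [v]" and ?Y = "d @ w # e @ a @ [v]"
  have "((a @ [v]) @ (?X @ d @ w # e)) # G # H # R \<in> D" using assms(1) F by simp
  from rotate[OF this] have "(?X @ ?Y) # G # H # R \<in> D" by simp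
  then obtain G' where G': "(?X @ ?Y) # (G' @ [v]) # H # R \<in> D"
    using rotate_to_end2 v by meson
  have "?X # (?Y @ (G' @ [v])) # H # R \<in> D \<or> ?Y # (?X @ (G' @ [v])) # H # R \<in> D"
    by (rule transfer[OF G', of v]) (auto simp: ends_at_def)
  then show False
    using no_three_words[of ?X "?Y @ (G' @ [v])" H R w]
      no_three_words[of ?Y "?X @ (G' @ [v])" H R w] w assms(2) by auto
qed

text \<open>If \<open>\<alpha>\<close>, \<open>\<beta>\<close>, \<open>\<gamma>\<close> can be split off, then merging at \<open>v\<close> and afterwards at \<open>w\<close> saves two words;
  if they are reordered instead, then \<open>v\<close> and \<open>w\<close> are interlaced in the new word or already were.\<close>

lemma no_triple:
  assumes D: "(\<alpha> @ \<beta> @ \<gamma>) # G # H # R \<in> D" and l: "length ((\<alpha> @ \<beta> @ \<gamma>) # G # H # R) = k"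
    and e: "ends_at u \<alpha>" "ends_at u \<beta>" "ends_at u \<gamma>"
    and v: "v \<in> set \<alpha>" "v \<in> set \<beta>" "v \<in> set G" and w: "w \<in> set \<beta>" "w \<in> set \<gamma>" "w \<in> set H"
    and "v \<noteq> w"
  shows False
  using split[OF D e]
proof
  assume d: "(\<alpha> @ \<gamma> @ \<beta>) # G # H # R \<in> D"
  obtain b1 b2 where b: "\<beta> = b1 @ v # b2" using v(2) by (auto simp: in_set_conv_decomp)
  obtain a1 a2 where a: "\<alpha> = a1 @ v # a2" using v(1) by (auto simp: in_set_conv_decomp)
  obtain c1 c2 where c: "\<gamma> = c1 @ w # c2" using w(2) by (auto simp: in_set_conv_decomp)
  \<comment> \<open>If w precedes v in \<beta>, the original order already interlaces v and w;
    otherwise the reordered word does.\<close>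
  show False
  proof (cases "w \<in> set b1")
    case True
    then obtain d1 d2 where "b1 = d1 @ w # d2" by (auto simp: in_set_conv_decomp)
    then have "\<alpha> @ \<beta> @ \<gamma> = a1 @ v # ((a2 @ d1) @ w # (d2 @ v # ((b2 @ c1) @ w # c2)))"
      using a b c by simp
    then have "subseq [v, w, v, w] (\<alpha> @ \<beta> @ \<gamma>)" 
      unfolding subseq_Cons_iff by blast
    then show False using no_interlace[OF D _ v(3) w(3)] l by simp
  next
    case False
    then have "w \<in> set b2" using w(1) b \<open>v \<noteq> w\<close> by simp
    then obtain d1 d2 where "b2 = d1 @ w # d2" by (auto simp: in_set_conv_decomp)
    then have "\<alpha> @ \<gamma> @ \<beta> = a1 @ v # ((a2 @ c1) @ w # ((c2 @ b1) @ v # (d1 @ w # d2)))"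
      using a b c by simp
    then have "subseq [v, w, v, w] (\<alpha> @ \<gamma> @ \<beta>)" 
      unfolding subseq_Cons_iff by blast
    then show False using no_interlace[OF d _ v(3) w(3)] l by simp
  qed
next
  assume "\<alpha> # \<beta> # \<gamma> # G # H # R \<in> D"
  then have "\<alpha> # \<beta> # G # \<gamma> # H # R \<in> D" by (rule permute) simp
  then obtain M where M: "M # \<gamma> # H # R \<in> D" "set M = set \<alpha> \<union> set \<beta> \<union> set G"
    using merge3 v by metis
  then obtain M' where "M' # R \<in> D" using merge3[OF M(1), of w] w M(2) by blast
  then show False using minimal[of "M' # R"] l by simp
qed

text \<open>Read cyclically, the three occurrences of u cut F into a segment with v, one with w and
  one with both. This is the situation of \<open>no_triple\<close> with v and w exchanged.\<close>

lemma no_fourfold: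
  assumes D: "F # G # H # R \<in> D" and l: "length (F # G # H # R) = k"
    and v: "v \<in> set G" and w: "w \<in> set H" and "v \<noteq> w"
    and s: "subseq [v, u, v, u, w, u, w] F"
  shows False
proof -
  obtain a b c d e f g h where
    F: "F = a @ v # b @ u # c @ v # d @ u # e @ w # f @ u # g @ w # h"
    using s unfolding subseq_Cons_iff by blast
  let ?\<alpha> = "e @ w # f @ [u]" and ?\<beta> = "g @ w # h @ a @ v # b @ [u]" and ?\<gamma> = "c @ v # d @ [u]"
  have "((a @ v # b @ u # c @ v # d @ [u]) @ (e @ w # f @ u # g @ w # h)) # G # H # R \<in> D"
    using D F by simp
  from rotate[OF this] have 1: "(e @ w # f @ u # g @ w # h @ a @ v # b @ u # c @ v # d @ [u]) # G # H # R \<in> D" by simp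
  have "(?\<alpha> @ ?\<beta> @ ?\<gamma>) # H # G # R \<in> D" using swap23[OF 1] by simp
  then show False
    by (rule no_triple[of _ _ _ _ _ _ u w v]) (use l v w \<open>v \<noteq> w\<close> in \<open>auto simp: ends_at_def\<close>)
qed

end

section \<open>Two words meeting a longest word\<close>

definition is_inner_nbr :: "'a \<Rightarrow> 'a list \<Rightarrow> 'a \<Rightarrow> bool" where
  "is_inner_nbr v P x \<longleftrightarrow> (\<exists>c. inner_nbr v P x c)"

lemma same_label_card:
  assumes "hd P = v"
  shows "finite {x. x \<noteq> v \<and> \<not> subseq [v, x, v, x] P \<and> is_inner_nbr v P x \<and> gap_label v P x = l}"
    "card {x. x \<noteq> v \<and> \<not> subseq [v, x, v, x] P \<and> is_inner_nbr v P x \<and> gap_label v P x = l} \<le> 2"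
proof -
  let ?S = "{x. x \<noteq> v \<and> \<not> subseq [v, x, v, x] P \<and> is_inner_nbr v P x \<and> gap_label v P x = l}"
  have sub: "?S \<subseteq> {x. inner_nbr v P x l \<and> x \<noteq> v}"
  proof
    fix x assume "x \<in> ?S"
    then have x: "x \<noteq> v" "\<not> subseq [v, x, v, x] P" "is_inner_nbr v P x" "gap_label v P x = l" by auto
    then obtain c where c: "inner_nbr v P x c" by (auto simp: is_inner_nbr_def)
    then have "c = l" using inner_nbr_label[OF x(2) assms x(1)] x(4) by blast
    then show "x \<in> {x. inner_nbr v P x l \<and> x \<noteq> v}" using c x by blast
  qed
  show "finite ?S" by (rule finite_subset[OF sub inner_nbr_card(1)])
  show "card ?S \<le> 2"
    using card_mono[OF inner_nbr_card(1) sub] inner_nbr_card(2)[of v P l] by linarith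
qed

lemma card_le_1_if: "finite A \<Longrightarrow> card A \<le> 2 \<Longrightarrow> c \<in> A \<Longrightarrow> card (A - {c}) \<le> 1"
  by simp

context min_word_system
begin

text \<open>The longest word \<open>F = P @ Q\<close> is cut such that \<open>v\<close> occurs only in \<open>P\<close> and \<open>w\<close> only in \<open>Q\<close>. By
  symmetry, statements about \<open>v\<close> carry over to \<open>w\<close>.\<close>

definition framed where
  "framed P Q G H R v w \<longleftrightarrow>
    (P @ Q) # (G @ [v]) # (H @ [w]) # R \<in> D \<and> length R + 3 = k \<and> v \<noteq> w \<and>
    P \<noteq> [] \<and> Q \<noteq> [] \<and> hd P = v \<and> hd Q = w \<and> v \<notin> set Q \<and> w \<notin> set P \<and> v \<notin> set G \<and> w \<notin> set H"

lemma framed_sym: "framed P Q G H R v w \<Longrightarrow> framed Q P H G R w v"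
  unfolding framed_def using rotate swap23 by blast

text \<open>In a frame v lies on no word besides F and \<open>G @ [v]\<close>, so the adjacency of
  these vertices to v is realized on \<open>G @ [v]\<close>.\<close>

definition outside_nbrs where
  "outside_nbrs P Q v w =
     {x \<in> V - {v, w}. adj v x \<and> \<not> cconsec (P @ Q) v x \<and> \<not> cconsec (P @ Q) x v}"

definition off_nbrs where
  "off_nbrs P v w = {x \<in> V - {v, w}. \<not> is_inner_nbr v P x}"

text \<open>In a frame such a vertex occurs between two occurrences of v and between two of w; these
  are the vertices that \<open>no_fourfold\<close> confines.\<close>

definition common_inner where
  "common_inner P Q v w = {x \<in> V - {v, w}. is_inner_nbr v P x \<and> is_inner_nbr w Q x}"

context
  fixes P Q G H :: "'v list" and R :: "'v list list" and v w :: 'v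
  assumes fr: "framed P Q G H R v w"
begin

lemma framedD:
  "(P @ Q) # (G @ [v]) # (H @ [w]) # R \<in> D" "length ((P @ Q) # (G @ [v]) # (H @ [w]) # R) = k"
  "v \<noteq> w" "P \<noteq> []" "Q \<noteq> []" "hd P = v" "hd Q = w" "v \<notin> set Q" "w \<notin> set P" "v \<notin> set G" "w \<notin> set H"
  "v \<in> set P" "w \<in> set Q"
  using fr hd_in_set[of P] hd_in_set[of Q] unfolding framed_def by auto

lemma v_in_V: "v \<in> V" "w \<in> V"
  using word_verts[OF framedD(1), of "P @ Q"] framedD(12,13) by auto

lemma third_word:
  assumes "u \<in> set (P @ Q)" "u \<in> set (G @ [v])"
  shows "u \<notin> set (H @ [w])" "xs \<in> set R \<Longrightarrow> u \<notin> set xs"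
proof -
  show "u \<notin> set (H @ [w])" using no_three_words[OF framedD(1,2)] assms by blast
  assume "xs \<in> set R"
  then obtain R1 R2 where R: "R = R1 @ xs # R2" by (auto simp: in_set_conv_decomp)
  have "(P @ Q) # (G @ [v]) # xs # (H @ [w]) # R1 @ R2 \<in> D"
    by (rule permute[OF framedD(1)]) (simp add: R)
  then show "u \<notin> set xs" 
    using no_three_words[of "P @ Q" "G @ [v]" xs "(H @ [w]) # R1 @ R2" u] framedD(2) assms R by auto
qed

lemma word_of_v:
  assumes "xs \<in> set ((P @ Q) # (G @ [v]) # (H @ [w]) # R)" "v \<in> set xs"
  shows "xs = P @ Q \<or> xs = G @ [v]"
proof -
  have "v \<in> set (P @ Q)" "v \<in> set (G @ [v])" using framedD(12) by simp_all
  from third_word[OF this] assms show ?thesis unfolding list.set insert_iff by blast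
qed

lemma outside_nbrs_G:
  assumes "x \<in> outside_nbrs P Q v w"
  shows "x \<in> {hd G, last G} \<and> x \<in> set G"
proof -
  have x: "adj v x" "\<not> cconsec (P @ Q) v x" "\<not> cconsec (P @ Q) x v" "x \<noteq> v"
    using assms by (auto simp: outside_nbrs_def)
  obtain xs where xs: "xs \<in> set ((P @ Q) # (G @ [v]) # (H @ [w]) # R)" "cconsec xs v x \<or> cconsec xs x v"
    using adj_word[OF x(1) framedD(1)] by blast
  have "v \<in> set xs" using xs(2) cconsec_in_set by metis
  moreover have "xs \<noteq> P @ Q" using xs x by auto
  ultimately have "xs = G @ [v]" using word_of_v[OF xs(1)] by blast
  moreover have "x \<in> set xs" using xs(2) cconsec_in_set by metis
  ultimately have "x = hd (G @ [v]) \<or> x = last G" "x \<in> set (G @ [v])"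
    using xs(2) consec_snoc_fresh[OF framedD(10), of x] x(4) 
    by (auto simp: cconsec_def dest: consec_in_set)
  then show ?thesis using x(4) by (cases G) auto
qed

lemma outside_nbrs_card: "finite (outside_nbrs P Q v w)" "card (outside_nbrs P Q v w) \<le> 2"
proof -
  have sub: "outside_nbrs P Q v w \<subseteq> {hd G, last G}" using outside_nbrs_G by blast
  then show "finite (outside_nbrs P Q v w)" by (rule finite_subset) simp
  have "card (outside_nbrs P Q v w) \<le> card {hd G, last G}" using sub by (intro card_mono) auto
  also have "\<dots> \<le> 2" by (simp add: card_insert_if)
  finally show "card (outside_nbrs P Q v w) \<le> 2" .
qed

text \<open>Apart from the inner gaps, v has only two neighbouring positions on F: right after its
  last occurrence in P, and across the seam, where the last letter of Q precedes the initial
  v.\<close>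

lemma outer_spot:
  assumes "x \<notin> {v, w}" "cconsec (P @ Q) v x \<or> cconsec (P @ Q) x v" "\<not> is_inner_nbr v P x"
  shows "x = last Q \<or> (\<exists>A B. P = A @ v # x # B \<and> v \<notin> set B)"
proof -
  have "\<not> consec Q v x" "\<not> consec Q x v" "last Q \<noteq> v"
    using framedD(5,8) by (auto dest: consec_in_set)
  then have "consec P v x \<or> consec P x v \<or> last Q = x"
    using assms(1,2) framedD(3-7) by (auto simp: cconsec_append)
  moreover have "\<not> consec P x v"
    using assms(3) unfolding consec_def is_inner_nbr_def inner_nbr_def by blast
  ultimately have "consec P v x \<or> last Q = x" by blast
  moreover have "v \<notin> set B" if "P = A @ v # x # B" for A B
    using assms(3) that unfolding is_inner_nbr_def inner_nbr_def by blast
  ultimately show ?thesis unfolding consec_def by blast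
qed

text \<open>The non-neighbours of v and the two positions of \<open>outer_spot\<close> would give N
  + 2. One is saved: if v and w are not adjacent, w is itself a non-neighbour but is not counted
  here; if they are adjacent, they meet at a seam of P and Q, and one of the two positions falls
  away.\<close>

lemma off_nbrs_card: "card (off_nbrs P v w - outside_nbrs P Q v w) \<le> N + 1"
proof -
  let ?U = "{x. \<exists>A B. P = A @ v # x # B \<and> v \<notin> set B}"
  \<comment> \<open>The letter after the last v of P is unique: no v remains behind it, so the
    number of v's before it is fixed.\<close>
  have "x = y" if xy: "x \<in> ?U" "y \<in> ?U" "x \<noteq> v" "y \<noteq> v" for x y
  proof -
    obtain A B A' B' where P: "P = A @ v # x # B" "P = A' @ v # y # B'"
      and nv: "v \<notin> set B" "v \<notin> set B'" using xy by blast
    have "count_list (x # B) v = 0" "count_list (y # B') v = 0"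
      using nv xy by (auto simp: count_list_0_iff)
    then have "count_list P v = Suc (count_list A v)" "count_list P v = Suc (count_list A' v)"
      using arg_cong[OF P(1), of "\<lambda>P. count_list P v"] arg_cong[OF P(2), of "\<lambda>P. count_list P v"]
      by (simp_all add: count_list_append)
    then have "x # B = y # B'"
      using P count_list_split_unique[of A v "x # B" A' "y # B'"] by simp
    then show ?thesis by simp
  qed
  then obtain s where s: "?U - {v} \<subseteq> {s}" by blast
  have fin: "finite {y \<in> V. y \<noteq> v \<and> \<not> adj v y}" using finite_V by simp
  have sub: "off_nbrs P v w - outside_nbrs P Q v w \<subseteq>
     ({y \<in> V. y \<noteq> v \<and> \<not> adj v y} - {w}) \<union> ({last Q} - {v, w}) \<union> (?U - {v})"
    unfolding off_nbrs_def outside_nbrs_def using outer_spot by blast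
  show ?thesis
  proof (cases "adj v w")
    case False
    then have "w \<in> {y \<in> V. y \<noteq> v \<and> \<not> adj v y}" using v_in_V framedD(3) by auto
    then have c: "Suc (card ({y \<in> V. y \<noteq> v \<and> \<not> adj v y} - {w})) \<le> N"
      using dense[OF v_in_V(1)] fin by (metis (no_types, lifting) card_Suc_Diff1)
    have "off_nbrs P v w - outside_nbrs P Q v w \<subseteq>
      ({y \<in> V. y \<noteq> v \<and> \<not> adj v y} - {w}) \<union> {last Q, s}" using sub s by blast
    then have "card (off_nbrs P v w - outside_nbrs P Q v w) \<le>
      card (({y \<in> V. y \<noteq> v \<and> \<not> adj v y} - {w}) \<union> {last Q, s})" using fin by (intro card_mono) auto
    also have "\<dots> \<le> card ({y \<in> V. y \<noteq> v \<and> \<not> adj v y} - {w}) + card {last Q, s}"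
      by (rule card_Un_le)
    also have "\<dots> \<le> N + 1" using c by (simp add: card_insert_if)
    finally show ?thesis .
  next
    case True
    then obtain xs where xs: "xs \<in> set ((P @ Q) # (G @ [v]) # (H @ [w]) # R)" "cconsec xs v w \<or> cconsec xs w v"
      using adj_word[OF True framedD(1)] by blast
    then have vw: "v \<in> set xs" "w \<in> set xs" using cconsec_in_set by metis+
    have "w \<notin> set (G @ [v])" using third_word(1)[of w] framedD(13) by fastforce
    then have "xs = P @ Q" using vw word_of_v[OF xs(1)] by blast
    moreover have "\<not> consec P v w" "\<not> consec P w v" "\<not> consec Q v w" "\<not> consec Q w v"
      "last P \<noteq> w" "last Q \<noteq> v"
      using framedD(4,5,8,9) by (auto dest: consec_in_set)
    ultimately have "last P = v \<or> last Q = w"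
      using xs(2) framedD(3-7) by (auto simp: cconsec_append)
    moreover have "?U - {v} = {}" if "last P = v"
    proof -
      have "x = v" if x: "P = A @ v # x # B" "v \<notin> set B" for x A B
        using x \<open>last P = v\<close> by (cases B rule: rev_cases) auto
      then show ?thesis by blast
    qed
    ultimately obtain t where t: "({last Q} - {v, w}) \<union> (?U - {v}) \<subseteq> {t}"
      using s by blast
    have "off_nbrs P v w - outside_nbrs P Q v w \<subseteq> {y \<in> V. y \<noteq> v \<and> \<not> adj v y} \<union> {t}"
      using sub t by blast
    then have "card (off_nbrs P v w - outside_nbrs P Q v w) \<le> card ({y \<in> V. y \<noteq> v \<and> \<not> adj v y} \<union> {t})"
      using fin by (intro card_mono) auto
    also have "\<dots> \<le> card {y \<in> V. y \<noteq> v \<and> \<not> adj v y} + card {t}" by (rule card_Un_le)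
    also have "\<dots> \<le> N + 1" using dense[OF v_in_V(1)] by simp
    finally show ?thesis .
  qed
qed

text \<open>Each such c has v, c, v in P and w, c, w in Q. One more c after v, c, v inside P would
  contradict \<open>no_fourfold\<close>. As v, c, v, c and, from the other side, w, c, w, c occur
  cyclically on F, \<open>no_interlace\<close> keeps c off every other word.\<close>

lemma common_inner_confined:
  assumes "c \<in> common_inner P Q v w"
  shows "\<not> subseq [v, c, v, c] P" "xs \<in> set ((G @ [v]) # (H @ [w]) # R) \<Longrightarrow> c \<notin> set xs"
proof -
  have c12: "c \<noteq> v" "c \<noteq> w" and inn: "is_inner_nbr v P c" "is_inner_nbr w Q c"
    using assms unfolding common_inner_def by blast+
  have "subseq [v, c, v] P" "subseq [w, c, w] Q"
    using inn inner_nbr_subseq[OF framedD(6) c12(1)] inner_nbr_subseq[OF framedD(7) c12(2)]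
    unfolding is_inner_nbr_def by blast+
  note c = c12 this
  show "\<not> subseq [v, c, v, c] P"
  proof
    assume "subseq [v, c, v, c] P"
    from list_emb_append_mono[OF this c(4)] have "subseq [v, c, v, c, w, c, w] (P @ Q)" by simp
    then show False using no_fourfold[OF framedD(1,2), of v w c] framedD(3) by simp
  qed
  have "subseq [c] Q" "subseq [c] P"
    using c(3,4) by (meson subseq_order.order_trans list_emb_Cons subseq_Cons2 list_emb_Nil)+
  then have vc: "subseq [v, c, v, c] (P @ Q)" "subseq [w, c, w, c] (Q @ P)"
    using list_emb_append_mono[OF c(3), of "[c]" Q] list_emb_append_mono[OF c(4), of "[c]" P] by simp_all
  have QP: "(Q @ P) # (H @ [w]) # (G @ [v]) # R \<in> D" using framedD(1) rotate swap23 by blast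
  assume "xs \<in> set ((G @ [v]) # (H @ [w]) # R)"
  then consider "xs = G @ [v]" | "xs = H @ [w]" | "xs \<in> set R" by auto
  then show "c \<notin> set xs"
  proof cases
    case 1
    then show ?thesis using no_interlace[OF QP _ _ _ vc(2)] framedD(2) by auto
  next
    case 2
    then show ?thesis using no_interlace[OF framedD(1,2) _ _ vc(1)] by auto
  next
    case 3
    then obtain R1 R2 where R: "R = R1 @ xs # R2" by (auto simp: in_set_conv_decomp)
    have "(P @ Q) # (G @ [v]) # xs # (H @ [w]) # R1 @ R2 \<in> D"
      by (rule permute[OF framedD(1)]) (simp add: R)
    from no_interlace[OF this _ _ _ vc(1)] show ?thesis using framedD(2) R by auto
  qed
qed

text \<open>By confinement c lies only on F. Since P begins with v and Q with w, no pair across a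
  seam avoids both, so the adjacency is realized inside P or inside Q.\<close>

lemma common_inner_adj:
  assumes "c \<in> common_inner P Q v w" "d \<notin> {v, w}" "adj c d"
  shows "consec P c d \<or> consec P d c \<or> consec Q c d \<or> consec Q d c"
proof -
  obtain xs where xs: "xs \<in> set ((P @ Q) # (G @ [v]) # (H @ [w]) # R)" "cconsec xs c d \<or> cconsec xs d c"
    using adj_word[OF assms(3) framedD(1)] by blast
  then have "c \<in> set xs" using cconsec_in_set by metis
  then have "xs = P @ Q" using xs(1) common_inner_confined(2)[OF assms(1), of xs] by auto
  moreover have "c \<noteq> v" "c \<noteq> w" using assms(1) by (auto simp: common_inner_def)
  ultimately show ?thesis using xs(2) assms(2) framedD(4-7) by (auto simp: cconsec_append)
qed

text \<open>Adjacency to w away from F places y on H. Once P contains v, y, v, a further y behind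
  it, in P or in Q, is excluded by \<open>no_interlace\<close>.\<close>

lemma outside_inner_confined:
  assumes "y \<in> outside_nbrs Q P w v" "is_inner_nbr v P y"
  shows "\<not> subseq [v, y, v, y] P" "y \<notin> set Q" "y \<in> set P" "y \<in> set H" "y \<noteq> v" "y \<noteq> w"
proof -
  show y: "y \<noteq> v" "y \<noteq> w" using assms(1) by (auto simp: outside_nbrs_def)
  have s: "subseq [v, y, v] P" 
    using assms(2) inner_nbr_subseq[OF framedD(6) y(1)] by (auto simp: is_inner_nbr_def)
  then show "y \<in> set P" by (auto simp: subseq_Cons_iff)
  show H: "y \<in> set H"
    using min_word_system.outside_nbrs_G[OF min_word_system_axioms framed_sym[OF fr] assms(1)] by blast
  have no: "\<not> subseq [v, y, v, y] (P @ Q)"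
    using no_interlace[OF framedD(1,2), of v y] H by auto
  then show "\<not> subseq [v, y, v, y] P" using list_emb_prefix by blast
  show "y \<notin> set Q"
    using no list_emb_append_mono[OF s, of "[y]" Q] by (auto simp: subseq_singleton_left)
qed

end

end

context min_word_system
begin

text \<open>
  Apart from \<open>v\<close>, \<open>w\<close> and at most \<open>2 (N + 1)\<close> exceptions, all vertices belong to \<open>S\<close>. A gap of \<open>v\<close>
  has two ends and therefore contains at most two of the vertices that are confined to a gap and
  next to \<open>v\<close>, and likewise for \<open>w\<close>. So a vertex of \<open>C\<close> is adjacent to at most two other
  vertices of \<open>S\<close>, and \<open>S\<close> is too small.
\<close>

lemma not_framed:
  assumes fr: "framed P Q G H R v w"
  shows False
proof -
  note fr' = framed_sym[OF fr]
  define C where "C = common_inner P Q v w"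
  define Xv where "Xv = outside_nbrs P Q v w"
  define Xw where "Xw = outside_nbrs Q P w v"
  \<comment> \<open>A vertex of \<open>Fv\<close> sits in the gaps of v on P, while its adjacency to
    w is realized on the word of H; \<open>Fw\<close> is the mirror case.\<close>
  define Fv where "Fv = {y \<in> Xw. is_inner_nbr v P y}"
  define Fw where "Fw = {y \<in> Xv. is_inner_nbr w Q y}"
  define S where "S = C \<union> Fv \<union> Fw \<union> (Xv \<inter> Xw)"
  have C_sym: "C = common_inner Q P w v" by (auto simp: C_def common_inner_def)
  note hP = framedD(6)[OF fr] and hQ = framedD(7)[OF fr]
  have Xv: "finite Xv" "card Xv \<le> 2" using outside_nbrs_card[OF fr] by (simp_all add: Xv_def)
  have Xw: "finite Xw" "card Xw \<le> 2" using outside_nbrs_card[OF fr'] by (simp_all add: Xw_def)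
  have SV: "S \<subseteq> V" "v \<notin> S" "w \<notin> S"
    by (auto simp: S_def C_def Xv_def Xw_def Fv_def Fw_def common_inner_def outside_nbrs_def)
  have finS: "finite S" using SV(1) finite_V finite_subset by blast
  have confv: "x \<noteq> v \<and> \<not> subseq [v, x, v, x] P \<and> is_inner_nbr v P x" if "x \<in> C \<union> Fv" for x
    using that common_inner_confined(1)[OF fr] outside_inner_confined(1)[OF fr]
    unfolding C_def Fv_def Xw_def by (auto simp: common_inner_def outside_nbrs_def)
  have confw: "x \<noteq> w \<and> \<not> subseq [w, x, w, x] Q \<and> is_inner_nbr w Q x" if "x \<in> C \<union> Fw" for x
    using that common_inner_confined(1)[OF fr'] outside_inner_confined(1)[OF fr']
    unfolding C_sym Fw_def Xv_def by (auto simp: common_inner_def outside_nbrs_def)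
  have Fv: "y \<notin> set Q" "y \<in> set P" "y \<in> set H" "y \<notin> {v, w}" if "y \<in> Fv" for y
    using that outside_inner_confined(2-6)[OF fr] unfolding Fv_def Xw_def by auto
  have Fw: "y \<notin> set P" "y \<in> set Q" "y \<in> set G" "y \<notin> {v, w}" if "y \<in> Fw" for y
    using that outside_inner_confined(2-6)[OF fr'] unfolding Fw_def Xv_def by auto
  \<comment> \<open>Such y lies on both G and H, so F would be a third word through y.\<close>
  have XX: "y \<notin> set (P @ Q)" if "y \<in> Xv \<inter> Xw" for y
    using that outside_nbrs_G[OF fr] outside_nbrs_G[OF fr'] third_word(1)[OF fr, of y]
    unfolding Xv_def Xw_def by auto
  define Lv where "Lv l = {x \<in> C \<union> Fv. gap_label v P x = l}" for l
  define Lw where "Lw l = {x \<in> C \<union> Fw. gap_label w Q x = l}" for l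
  have Lv: "card (Lv l) \<le> 2" for l
    using order_trans[OF card_mono[OF same_label_card(1)[OF hP, of l], of "Lv l"] same_label_card(2)[OF hP]]
      confv unfolding Lv_def by blast
  have Lw: "card (Lw l) \<le> 2" for l
    using order_trans[OF card_mono[OF same_label_card(1)[OF hQ, of l], of "Lw l"] same_label_card(2)[OF hQ]]
      confw unfolding Lw_def by blast
  have finL: "finite (Lv l)" "finite (Lw l)" for l
    by (rule finite_subset[OF _ finS], force simp: Lv_def Lw_def S_def)+
  \<comment> \<open>The adjacency runs inside P or inside Q. There d is confined as well, and
    \<open>consec_same_label\<close> puts it into the gap of c.\<close>
  have adjS: "d \<in> Lv (gap_label v P c) \<or> d \<in> Lw (gap_label w Q c)" 
    if c: "c \<in> C" and d: "d \<in> S" and a: "adj c d" for c d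
  proof -
    have dvw: "d \<notin> {v, w}" using d SV by auto
    have "consec P c d \<or> consec P d c \<or> consec Q c d \<or> consec Q d c"
      using common_inner_adj[OF fr _ dvw a] c by (simp add: C_def)
    then have "(d \<in> set P \<and> (consec P c d \<or> consec P d c)) \<or> (d \<in> set Q \<and> (consec Q c d \<or> consec Q d c))"
      using consec_in_set by metis
    then show ?thesis
    proof
      assume p: "d \<in> set P \<and> (consec P c d \<or> consec P d c)"
      then have dC: "d \<in> C \<union> Fv" using d Fw(1) XX unfolding S_def by auto
      then have "gap_label v P c = gap_label v P d"
        using p consec_same_label[of v c P d] consec_same_label[of v d P c] confv[of c] confv[of d] c hP
        by auto
      then show ?thesis using dC by (simp add: Lv_def)
    next
      assume p: "d \<in> set Q \<and> (consec Q c d \<or> consec Q d c)"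
      then have dC: "d \<in> C \<union> Fw" using d Fv(1) XX unfolding S_def by auto
      then have "gap_label w Q c = gap_label w Q d"
        using p consec_same_label[of w c Q d] consec_same_label[of w d Q c] confw[of c] confw[of d] c hQ
        by auto
      then show ?thesis using dC by (simp add: Lw_def)
    qed
  qed
  \<comment> \<open>Besides c itself there are at most N non-neighbours and one further vertex in
    each of the two gaps of c.\<close>
  have S_le: "card S \<le> N + 3" if c: "c \<in> C" for c
  proof -
    have cV: "c \<in> V" using c SV(1) by (auto simp: S_def)
    let ?n = "{y \<in> V. y \<noteq> c \<and> \<not> adj c y}"
    have mem: "c \<in> Lv (gap_label v P c)" "c \<in> Lw (gap_label w Q c)" using c by (auto simp: Lv_def Lw_def)
    have "S \<subseteq> {c} \<union> ?n \<union> (Lv (gap_label v P c) - {c}) \<union> (Lw (gap_label w Q c) - {c})"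
      using adjS[OF c] SV(1) by blast
    then have "card S \<le> card ({c} \<union> ?n \<union> (Lv (gap_label v P c) - {c}) \<union> (Lw (gap_label w Q c) - {c}))"
      using finite_V finL by (intro card_mono) auto
    also have "\<dots> \<le> card {c} + card ?n + card (Lv (gap_label v P c) - {c}) + card (Lw (gap_label w Q c) - {c})"
      by (meson add_mono card_Un_le le_trans order_refl)
    also have "\<dots> \<le> 1 + N + 1 + 1"
      using dense[OF cV] card_le_1_if[OF finL(1) Lv mem(1)] card_le_1_if[OF finL(2) Lw mem(2)] by auto
    finally show ?thesis by simp
  qed
  have cover: "V \<subseteq> {v, w} \<union> (off_nbrs P v w - Xv) \<union> (off_nbrs Q w v - Xw) \<union> S"
    by (auto simp: S_def off_nbrs_def C_def common_inner_def Fv_def Fw_def)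
  have fin_off: "finite (off_nbrs P v w)" "finite (off_nbrs Q w v)"
    using finite_V by (auto simp: off_nbrs_def)
  have "card V \<le> card ({v, w} \<union> (off_nbrs P v w - Xv) \<union> (off_nbrs Q w v - Xw) \<union> S)"
    using cover fin_off finS by (intro card_mono) auto
  also have "\<dots> \<le> card {v, w} + card (off_nbrs P v w - Xv) + card (off_nbrs Q w v - Xw) + card S"
    by (meson add_mono card_Un_le le_trans order_refl)
  also have "\<dots> \<le> 2 + (N + 1) + (N + 1) + card S"
    using off_nbrs_card[OF fr] off_nbrs_card[OF fr'] unfolding Xv_def Xw_def
    by (intro add_mono) (auto simp: card_insert_if)
  \<comment> \<open>This is 5 N + 7 - 2 - 2 (N + 1).\<close>
  finally have big: "3 * N + 3 \<le> card S" using large by simp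
  have S_empty: "card S \<le> 4" if "C = {}"
  proof -
    have "S \<subseteq> Xv \<union> Xw" using that by (auto simp: S_def Fv_def Fw_def)
    then have "card S \<le> card (Xv \<union> Xw)" using Xv Xw by (intro card_mono) auto
    also have "\<dots> \<le> 4" using card_Un_le[of Xv Xw] Xv(2) Xw(2) by simp
    finally show ?thesis .
  qed
  \<comment> \<open>Comparing 3 N + 3 with N + 3, or with 4 when C is empty, leaves only the case
    where all vertices are pairwise adjacent.\<close>
  have N0: "N = 0"
  proof (cases "C = {}")
    case True
    then show ?thesis using big S_empty by simp
  next
    case False
    then show ?thesis using big S_le by fastforce
  qed
  have complete: "adj x y" if "x \<in> V" "y \<in> V" "x \<noteq> y" for x y
  proof -
    have "{y \<in> V. y \<noteq> x \<and> \<not> adj x y} = {}" using dense[OF that(1)] N0 finite_V by simp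
    then show ?thesis using that by blast
  qed
  \<comment> \<open>The vertex x lies on F and H, and y on F and G, so F is the only word they can
    share; but on F, x stays in P and y in Q.\<close>
  have FF: False if x: "x \<in> Fv" and y: "y \<in> Fw" for x y
  proof -
    have "x \<noteq> y" using Fv(1)[OF x] Fw(2)[OF y] by blast
    moreover have "x \<in> V" "y \<in> V" using SV(1) x y unfolding S_def by blast+
    ultimately have "adj x y" using complete by blast
    then obtain xs where xs: "xs \<in> set ((P @ Q) # (G @ [v]) # (H @ [w]) # R)" "cconsec xs x y \<or> cconsec xs y x"
      using adj_word[OF _ framedD(1)[OF fr]] by blast
    then have xy: "x \<in> set xs" "y \<in> set xs" using cconsec_in_set by metis+
    have "xs \<noteq> H @ [w]" using third_word(1)[OF fr, of y] Fw[OF y] xy(2) by auto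
    moreover have "xs \<noteq> G @ [v]" using third_word(1)[OF fr, of x] Fv[OF x] xy(1) by auto
    moreover have "xs \<notin> set R" using third_word(2)[OF fr, of y] Fw[OF y] xy(2) by auto
    ultimately have "xs = P @ Q" using xs(1) by auto
    then have "consec P x y \<or> consec P y x \<or> consec Q x y \<or> consec Q y x"
      using xs(2) Fv(4)[OF x] Fw(4)[OF y] framedD(4-7)[OF fr] by (auto simp: cconsec_append)
    then show False using Fv(1)[OF x] Fw(1)[OF y] consec_in_set by metis
  qed
  show False
  proof (cases "C = {}")
    case True
    have "S \<subseteq> Xv \<or> S \<subseteq> Xw"
      using FF True unfolding S_def Fv_def Fw_def by blast
    then have "card S \<le> 2"
      using card_mono[OF Xv(1), of S] card_mono[OF Xw(1), of S] Xv(2) Xw(2) by linarith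
    then show False using big by simp
  next
    case False
    then obtain c where c: "c \<in> C" by blast
    let ?l = "gap_label v P c" and ?l' = "gap_label w Q c"
    have mem: "c \<in> Lv ?l" "c \<in> Lw ?l'" using c by (auto simp: Lv_def Lw_def)
    have cS: "c \<in> S" using c by (simp add: S_def)
    have S_sub: "S - {c} \<subseteq> (Lv ?l - {c}) \<union> (Lw ?l' - {c})"
      using adjS[OF c] complete SV(1) cS by blast
    have c1: "card (Lv ?l - {c}) \<le> 1" "card (Lw ?l' - {c}) \<le> 1"
      using card_le_1_if[OF finL(1) Lv mem(1)] card_le_1_if[OF finL(2) Lw mem(2)] by auto
    have "2 \<le> card (S - {c})" using big cS finS by simp
    moreover have "\<not> S - {c} \<subseteq> Lw ?l' - {c}" "\<not> S - {c} \<subseteq> Lv ?l - {c}"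
      using calculation c1 finL card_mono[of "Lw ?l' - {c}" "S - {c}"] card_mono[of "Lv ?l - {c}" "S - {c}"]
      by fastforce+
    \<comment> \<open>Each of the two gaps of c has room for only one more vertex, so d and d'
      occupy one gap each. Being adjacent, they would share a gap if one of them is in C, and
      \<open>FF\<close> excludes the remaining case.\<close>
    ultimately obtain d d' where d: "d \<in> S" "d \<noteq> c" "d \<in> Lv ?l" "d \<notin> Lw ?l'"
      and d': "d' \<in> S" "d' \<noteq> c" "d' \<in> Lw ?l'" "d' \<notin> Lv ?l"
      using S_sub by blast
    have three: False if "x \<in> A" "y \<in> A" "z \<in> A" "x \<noteq> y" "x \<noteq> z" "y \<noteq> z" "card A \<le> 2" "finite A"
      for x y z :: 'v and A
      using card_mono[OF that(8), of "{x, y, z}"] that by auto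
    have "d \<noteq> d'" using d d' by blast
    then have add: "adj d d'" using complete d(1) d'(1) SV(1) by blast
    show False
    proof (cases "d \<in> C")
      case True
      from adjS[OF True d'(1) add] show False
      proof
        assume "d' \<in> Lv (gap_label v P d)"
        then show False using d(3) d'(4) by (simp add: Lv_def)
      next
        assume "d' \<in> Lw (gap_label w Q d)"
        then have "d \<in> Lw ?l'" using d' True by (simp add: Lw_def)
        then show False using d(4) by simp
      qed
    next
      case False
      then have dF: "d \<in> Fv" using d(3) by (auto simp: Lv_def)
      show False
      proof (cases "d' \<in> C")
        case True
        from adjS[OF True d(1) adj_sym[OF add]] show False
        proof
          assume "d \<in> Lv (gap_label v P d')"
          then have "d' \<in> Lv ?l" using d True by (simp add: Lv_def)
          then show False using d'(4) by simp
        next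
          assume "d \<in> Lw (gap_label w Q d')"
          then show False using d(4) d'(3) by (simp add: Lw_def)
        qed
      next
        case False
        then have "d' \<in> Fw" using d'(3) by (auto simp: Lw_def)
        then show False using FF dF by blast
      qed
    qed
  qed
qed

end

section \<open>Reduction to two words\<close>

context min_word_system
begin

definition longest :: "'v list \<Rightarrow> bool" where
  "longest F \<longleftrightarrow> (\<forall>Ls \<in> D. length Ls = k \<longrightarrow> (\<forall>xs \<in> set Ls. length xs \<le> length F))"

lemma word_has_vertex: "Ls \<in> D \<Longrightarrow> xs \<in> set Ls \<Longrightarrow> \<exists>x. x \<in> set xs"
  using word_nonempty by (metis ex_in_conv set_empty)

lemma nonnbrs_card:
  assumes "x \<in> V" "A \<subseteq> {y \<in> V. y \<noteq> x \<and> \<not> adj x y}"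
  shows "card A \<le> N"
  using card_mono[OF _ assms(2)] dense[OF assms(1)] finite_V by simp

text \<open>Otherwise a segment of \<open>G\<close> could be transferred to \<open>F\<close>.\<close>

lemma single_occurrence:
  assumes D: "F # G # R \<in> D" and l: "length (F # G # R) = k" and F: "longest F"
    and u: "u \<in> set F" "u \<in> set G"
  obtains G' where "F # (G' @ [u]) # R \<in> D" "u \<notin> set G'" "set (G' @ [u]) = set G"
proof -
  obtain G' where G': "F # (G' @ [u]) # R \<in> D" "mset (G' @ [u]) = mset G"
    using rotate_to_end2[OF D u(2)] by blast
  have "u \<notin> set G'"
  proof
    assume "u \<in> set G'"
    then obtain G1 G2 where g: "G' = G1 @ u # G2" by (auto simp: in_set_conv_decomp)
    obtain F' where F': "(F' @ [u]) # (G' @ [u]) # R \<in> D" "mset (F' @ [u]) = mset F"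
      using rotate_to_end[OF G'(1) u(1)] by blast
    have "((G1 @ [u]) @ (G2 @ [u])) # (F' @ [u]) # R \<in> D" using swap12[OF F'(1)] g by simp
    from transfer[OF this ends_at_snoc ends_at_snoc ends_at_snoc]
    obtain X Y where XY: "X # (Y @ F' @ [u]) # R \<in> D" "Y \<noteq> []"
      by (metis append_is_Nil_conv not_Cons_self2)
    have "length (F' @ [u]) = length F" using F'(2) by (metis size_mset)
    moreover have "length (Y @ F' @ [u]) \<le> length F"
      using F XY(1) l unfolding longest_def by force
    ultimately show False using XY(2) by simp
  qed
  moreover have "set (G' @ [u]) = set G" using G'(2) by (metis set_mset_mset)
  ultimately show thesis using that G'(1) by blast
qed

text \<open>As v and w do not interlace on F, some rotation of F lists all occurrences of v before
  all those of w; together with \<open>single_occurrence\<close> this yields a frame.\<close>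

lemma no_two_touching:
  assumes D: "F # G # H # R \<in> D" and l: "length (F # G # H # R) = k" and F: "longest F"
    and v: "v \<in> set F" "v \<in> set G" and w: "w \<in> set F" "w \<in> set H"
  shows False
proof -
  have vw: "v \<noteq> w" using no_three_words[OF D l] v w by blast
  obtain G' where G': "F # (G' @ [v]) # H # R \<in> D" "v \<notin> set G'" "set (G' @ [v]) = set G"
    by (rule single_occurrence[OF D l F v])
  have l': "length (F # H # (G' @ [v]) # R) = k" using l by simp
  obtain H' where H'D: "F # (H' @ [w]) # (G' @ [v]) # R \<in> D" and H': "w \<notin> set H'"
    and "set (H' @ [w]) = set H"
    by (rule single_occurrence[OF swap23[OF G'(1)] l' F w])
  from H'D have D1: "F # (G' @ [v]) # (H' @ [w]) # R \<in> D" by (rule swap23)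
  obtain A0 B0 where "F = A0 @ v # B0" using v(1) by (auto simp: in_set_conv_decomp)
  moreover have "w \<in> set (B0 @ A0)" using calculation w(1) vw by auto
  ultimately have D2: "(v # (B0 @ A0)) # (G' @ [v]) # (H' @ [w]) # R \<in> D"
    using rotate[of A0 "v # B0"] D1 by simp
  obtain A B where AB: "B0 @ A0 = A @ w # B" "w \<notin> set A"
    using split_list_first[OF \<open>w \<in> set (B0 @ A0)\<close>] by blast
  have D3: "(v # A @ w # B) # (G' @ [v]) # (H' @ [w]) # R \<in> D" using D2 AB by simp
  show False
  proof (cases "v \<in> set B")
    case True
    then obtain B1 B2 where B: "B = B1 @ v # B2" "v \<notin> set B1" using split_list_first[of v B] by blast
    have "w \<notin> set B2"
    proof
      assume "w \<in> set B2"
      then obtain B3 B4 where "B2 = B3 @ w # B4" by (auto simp: in_set_conv_decomp)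
      then have "v # A @ w # B = [] @ v # (A @ w # (B1 @ v # (B3 @ w # B4)))" using B by simp
      then have s: "subseq [v, w, v, w] (v # A @ w # B)" unfolding subseq_Cons_iff by blast
      show False using no_interlace[OF D3 _ _ _ s] l by simp
    qed
    \<comment> \<open>No w follows this v, so the end of the word from here on moves to the front
      and joins the part of v.\<close>
    have "((v # A @ w # B1) @ v # B2) # (G' @ [v]) # (H' @ [w]) # R \<in> D" using D3 B by simp
    from rotate[OF this] have "((v # B2 @ v # A) @ (w # B1)) # (G' @ [v]) # (H' @ [w]) # R \<in> D"
      by simp
    then have "framed (v # B2 @ v # A) (w # B1) G' H' R v w"
      unfolding framed_def using l vw AB B H' G' \<open>w \<notin> set B2\<close> by auto
    then show False by (rule not_framed)
  next
    case False
    then have "framed (v # A) (w # B) G' H' R v w"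
      unfolding framed_def using D3 l vw AB H' G' by auto
    then show False by (rule not_framed)
  qed
qed

text \<open>This shapes K for \<open>transfer\<close> at b: \<open>g @ [b]\<close> is one full gap
  of b containing a, and Y is the rest, empty when b occurs only once.\<close>

lemma gap_rotation:
  assumes "K # R \<in> D" "a \<in> set K" "b \<in> set K" "a \<noteq> b"
  obtains g Y where "((g @ [b]) @ Y) # R \<in> D" "a \<in> set g" "b \<notin> set g" "Y = [] \<or> ends_at b Y"
proof -
  obtain A B where "K = A @ a # B" using assms(2) by (auto simp: in_set_conv_decomp)
  moreover have "b \<in> set (B @ A)" using calculation assms(3,4) by auto
  ultimately have D: "(a # (B @ A)) # R \<in> D" using rotate[of A "a # B"] assms(1) by simp
  obtain z1 z2 where z: "B @ A = z1 @ b # z2" "b \<notin> set z1"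
    using split_list_first[OF \<open>b \<in> set (B @ A)\<close>] by blast
  have D': "((a # z1 @ [b]) @ z2) # R \<in> D" using D z by simp
  show thesis
  proof (cases "b \<in> set z2")
    case False
    have "(((z2 @ a # z1) @ [b]) @ []) # R \<in> D" using rotate[OF D'] by simp
    then show thesis by (rule that) (use False z assms(4) in auto)
  next
    case True
    then obtain y1 y2 where y: "z2 = y1 @ b # y2" "b \<notin> set y2" using split_list_last[of b z2] by blast
    have "((a # z1 @ [b] @ y1 @ [b]) @ y2) # R \<in> D" using D' y by simp
    from rotate[OF this] have "(((y2 @ a # z1) @ [b]) @ (y1 @ [b])) # R \<in> D" by simp
    then show thesis by (rule that) (use y z assms(4) in \<open>auto simp: ends_at_def\<close>)
  qed
qed

text \<open>If a word \<open>H\<close> avoids \<open>F\<close>, then a vertex \<open>b\<close> of \<open>H\<close> has at least three neighbours on \<open>F\<close>, all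
  along one further word \<open>K\<close>. Hence two gaps of \<open>b\<close> in \<open>K\<close> meet \<open>F\<close>, and after transferring a
  segment of \<open>K\<close> to \<open>H\<close> both words meet \<open>F\<close>.\<close>

lemma no_longest:
  assumes D: "F # R \<in> D" and l: "length (F # R) = k" and F: "longest F"
  shows False
proof -
  have FV: "set F \<subseteq> V" using word_verts[OF D] by simp
  \<comment> \<open>If F met no other word, no edge would join F to the remaining vertices, and both
    sides would have at most N vertices.\<close>
  have "\<exists>G \<in> set R. set F \<inter> set G \<noteq> {}"
  proof (rule ccontr)
    assume no: "\<not> (\<exists>G \<in> set R. set F \<inter> set G \<noteq> {})"
    have nadj: "\<not> adj a b" if "a \<in> set F" "b \<notin> set F" for a b
      using adj_word[OF _ D, of a b] cconsec_in_set that no by (metis disjoint_iff set_ConsD)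
    obtain a where a: "a \<in> set F" using word_has_vertex[OF D, of F] by auto
    obtain G where G: "G \<in> set R" using l k_ge by (cases R) auto
    then obtain b where b: "b \<in> set G" using word_has_vertex[OF D, of G] G by auto
    have bV: "b \<in> V" "b \<notin> set F" using word_verts[OF D, of G] G b no by auto
    have "V - set F \<subseteq> {y \<in> V. y \<noteq> a \<and> \<not> adj a y}" using nadj a by auto
    then have 1: "card (V - set F) \<le> N"
      using nonnbrs_card a FV by blast
    have "set F \<subseteq> {y \<in> V. y \<noteq> b \<and> \<not> adj b y}" using nadj bV FV adj_sym by blast
    then have 2: "card (set F) \<le> N"
      using nonnbrs_card bV(1) by blast
    have "card V = card (V - set F) + card (set F)"
      using FV finite_V by (metis card_Diff_subset card_mono finite_set le_add_diff_inverse2)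
    then show False using 1 2 large by simp
  qed
  then obtain G v where Gv: "G \<in> set R" "v \<in> set F" "v \<in> set G" by blast
  obtain S where S: "mset R = mset (G # S)" using Gv(1)
    by (metis in_set_conv_decomp mset.simps(2) mset_append union_mset_add_mset_right)
  have D1: "F # G # S \<in> D" using permute[OF D] S by simp
  have lS: "length S + 2 = k" using l S by (metis length_Cons size_mset add_2_eq_Suc')
  then obtain H T where HT: "S = H # T" using k_ge by (cases S) auto
  have D2: "F # G # H # T \<in> D" and l2: "length (F # G # H # T) = k" using D1 HT lS by auto
  have disj: "set F \<inter> set H = {}" using no_two_touching[OF D2 l2 F Gv(2,3)] by blast
  obtain b where b: "b \<in> set H" using word_has_vertex[OF D2, of H] by auto
  have bF: "b \<notin> set F" using b disj by blast
  have bV: "b \<in> V" using word_verts[OF D2, of H] b by auto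
  have vV: "v \<in> V" using FV Gv by blast
  obtain G' where G': "F # (G' @ [v]) # H # T \<in> D" "v \<notin> set G'" "set (G' @ [v]) = set G"
    by (rule single_occurrence[OF D2 l2 F Gv(2,3)])
  \<comment> \<open>No third word passes through v, and F misses x. So the adjacency lies on
    \<open>G' @ [v]\<close>, where v has only two neighbouring positions; hence almost all vertices
    are on F.\<close>
  have nbr_v: "x \<in> {hd (G' @ [v]), last G'}" if ax: "adj v x" "x \<notin> set F" for x
  proof -
    obtain xs where xs: "xs \<in> set (F # (G' @ [v]) # H # T)" "cconsec xs v x \<or> cconsec xs x v"
      using adj_word[OF ax(1) G'(1)] by blast
    then have vx: "v \<in> set xs" "x \<in> set xs" using cconsec_in_set by metis+
    have "xs = G' @ [v]"
    proof (rule ccontr)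
      assume "xs \<noteq> G' @ [v]"
      then have "xs \<in> set (H # T)" using xs(1) vx ax(2) by auto
      then obtain T1 T2 where T: "H # T = T1 @ xs # T2" by (metis split_list)
      have "F # (G' @ [v]) # xs # (T1 @ T2) \<in> D"
        by (rule permute[OF G'(1)]) (simp add: T)
      then show False
        using no_three_words[of F "G' @ [v]" xs "T1 @ T2" v] arg_cong[OF T, of length] l2 vx Gv(2) by simp
    qed
    moreover have "x \<noteq> v" using ax Gv(2) by auto
    ultimately show ?thesis using xs(2) consec_snoc_fresh[OF G'(2)] by (auto simp: cconsec_def)
  qed
  have "V - set F \<subseteq> {y \<in> V. y \<noteq> v \<and> \<not> adj v y} \<union> {hd (G' @ [v]), last G'}"
    using nbr_v Gv(2) by blast
  then have "card (V - set F) \<le> card ({y \<in> V. y \<noteq> v \<and> \<not> adj v y} \<union> {hd (G' @ [v]), last G'})"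
    using finite_V by (intro card_mono) auto
  also have "\<dots> \<le> card {y \<in> V. y \<noteq> v \<and> \<not> adj v y} + card {hd (G' @ [v]), last G'}" by (rule card_Un_le)
  also have "\<dots> \<le> N + 2" using dense[OF vV] by (intro add_mono) (auto simp: card_insert_if)
  finally have c1: "card (V - set F) \<le> N + 2" .
  define T0 where "T0 = {a \<in> set F. adj b a}"
  have "V \<subseteq> (V - set F) \<union> T0 \<union> {y \<in> V. y \<noteq> b \<and> \<not> adj b y}"
    using bF by (auto simp: T0_def)
  then have "card V \<le> card ((V - set F) \<union> T0 \<union> {y \<in> V. y \<noteq> b \<and> \<not> adj b y})"
    using finite_V by (intro card_mono) (auto simp: T0_def)
  also have "\<dots> \<le> card (V - set F) + card T0 + card {y \<in> V. y \<noteq> b \<and> \<not> adj b y}"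
    by (meson add_mono card_Un_le le_trans order_refl)
  also have "\<dots> \<le> (N + 2) + card T0 + N" using c1 dense[OF bV] by simp
  finally have T0: "3 \<le> card T0" using large by simp
  then obtain a where a: "a \<in> T0" by (metis card.empty equals0I not_numeral_le_zero)
  obtain K where K: "K \<in> set (F # G # H # T)" "cconsec K b a \<or> cconsec K a b"
    using adj_word[OF _ D2, of b a] a by (auto simp: T0_def)
  then have K2: "a \<in> set K" "b \<in> set K" using cconsec_in_set by metis+
  have aF: "a \<in> set F" using a by (simp add: T0_def)
  have "K \<in> set (G # T)" using K(1) K2 bF aF disj by auto
  then obtain T1 T2 where T: "G # T = T1 @ K # T2" by (metis split_list)
  let ?T = "T1 @ T2"
  have D3: "K # F # H # ?T \<in> D"
  proof (rule permute[OF D2])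
    have "mset (F # G # H # T) = mset (F # H # (G # T))" by simp
    then show "mset (F # G # H # T) = mset (K # F # H # ?T)" unfolding T by simp
  qed
  have lT: "length ?T + 3 = k" using l2 arg_cong[OF T, of length] by simp
  obtain g Y where gY: "((g @ [b]) @ Y) # F # H # ?T \<in> D" "a \<in> set g" "b \<notin> set g" "Y = [] \<or> ends_at b Y"
    using gap_rotation[OF D3 K2] aF bF by metis
  let ?K = "(g @ [b]) @ Y"
  have D4: "?K # H # F # ?T \<in> D" using swap23[OF gY(1)] .
  show False
  proof (cases "set Y \<inter> set F = {}")
    case False
    then obtain a' where a': "a' \<in> set Y" "a' \<in> set F" by blast
    then have Y: "ends_at b Y" using gY(4) by auto
    obtain H' where H': "?K # (H' @ [b]) # F # ?T \<in> D" "mset (H' @ [b]) = mset H"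
      using rotate_to_end2[OF D4 b] by blast
    from transfer[OF H'(1) ends_at_snoc Y ends_at_snoc] show False
    proof
      assume "(g @ [b]) # (Y @ H' @ [b]) # F # ?T \<in> D"
      then have "F # (g @ [b]) # (Y @ H' @ [b]) # ?T \<in> D" by (rule permute) simp
      from no_two_touching[OF this _ F aF _ a'(2)] show False using lT gY(2) a'(1) by simp
    next
      assume "Y # ((g @ [b]) @ H' @ [b]) # F # ?T \<in> D"
      then have "F # ((g @ [b]) @ H' @ [b]) # Y # ?T \<in> D" by (rule permute) simp
      from no_two_touching[OF this _ F aF _ a'(2)] show False using lT gY(2) a'(1) by simp
    qed
  next
    case True
    \<comment> \<open>Now only the gap g of b meets F, and its two ends leave room for two
      neighbours of b.\<close>
    have "T0 \<subseteq> {last g, hd (g @ [b])}"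
    proof
      fix x assume x: "x \<in> T0"
      then have xF: "x \<in> set F" "adj b x" by (auto simp: T0_def)
      obtain xs where xs: "xs \<in> set (?K # H # F # ?T)" "cconsec xs b x \<or> cconsec xs x b"
        using adj_word[OF xF(2) D4] by blast
      then have bx: "b \<in> set xs" "x \<in> set xs" using cconsec_in_set by metis+
      have "xs \<notin> set ?T"
      proof
        assume "xs \<in> set ?T"
        then obtain S1 S2 where S: "?T = S1 @ xs # S2" by (metis split_list)
        have "?K # H # xs # (F # S1 @ S2) \<in> D" by (rule permute[OF D4]) (simp add: S)
        then show False
          using no_three_words[of ?K H xs "F # S1 @ S2" b] b bx lT arg_cong[OF S, of length] by simp
      qed
      then have "xs = ?K" using xs(1) bx xF bF disj by auto
      have xb: "x \<noteq> b" "x \<notin> set Y" using xF bF True by auto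
      have nY: "\<not> consec Y b x" "\<not> consec Y x b" using xb by (auto dest: consec_in_set)
      show "x \<in> {last g, hd (g @ [b])}"
      proof (cases "Y = []")
        case True
        then show ?thesis using xs(2) \<open>xs = ?K\<close> xb consec_snoc_fresh[OF gY(3)]
          by (auto simp: cconsec_def)
      next
        case False
        moreover have "hd Y \<noteq> x" "last Y \<noteq> x" using False xb by auto
        moreover have "g @ [b] \<noteq> []" by simp
        ultimately show ?thesis using xs(2) xb consec_snoc_fresh[OF gY(3)] nY
          unfolding \<open>xs = ?K\<close> cconsec_append[OF \<open>g @ [b] \<noteq> []\<close> False] by auto
      qed
    qed
    then have "card T0 \<le> card {last g, hd (g @ [b])}" by (intro card_mono) auto
    also have "\<dots> \<le> 2" by (simp add: card_insert_if)
    finally show False using T0 by simp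
  qed
qed

lemma not_attained: "Ls \<in> D \<Longrightarrow> length Ls \<noteq> k"
proof
  assume Ls: "Ls \<in> D" "length Ls = k"
  define P where "P = (\<lambda>F. \<exists>Ls \<in> D. length Ls = k \<and> F \<in> set Ls)"
  have "hd Ls \<in> set Ls" using Ls k_ge by (cases Ls) auto
  then have "P (hd Ls)" using Ls unfolding P_def by blast
  moreover have "\<forall>F. P F \<longrightarrow> length F < Suc m"
  proof (intro allI impI)
    fix F assume "P F"
    then obtain Ls where "Ls \<in> D" "F \<in> set Ls" unfolding P_def by blast
    then have "length F \<le> sum_list (map length Ls)" by (intro member_le_sum_list) auto
    then show "length F < Suc m" using total_length[OF \<open>Ls \<in> D\<close>] by (simp add: length_concat)
  qed
  ultimately have "\<exists>F. P F \<and> (\<forall>F'. P F' \<longrightarrow> length F' \<le> length F)"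
    by (rule ex_has_greatest_nat)
  then obtain F where F: "P F" "\<forall>F'. P F' \<longrightarrow> length F' \<le> length F"
    by blast
  then have "longest F" unfolding longest_def P_def by blast
  obtain Ks where K: "Ks \<in> D" "length Ks = k" "F \<in> set Ks" using F(1) unfolding P_def by blast
  obtain A B where AB: "Ks = A @ F # B" using K(3) by (auto dest: split_list)
  have "F # A @ B \<in> D" by (rule permute[OF K(1)]) (simp add: AB)
  from no_longest[OF this _ \<open>longest F\<close>] show False using K(2) AB by simp
qed

end

theorem (in word_system) at_most_two_words: "\<exists>Ls \<in> D. length Ls \<le> 2"
proof (rule ccontr)
  assume no: "\<not> (\<exists>Ls \<in> D. length Ls \<le> 2)"
  obtain Ls where Ls: "Ls \<in> D" "\<forall>Ks. Ks \<in> D \<longrightarrow> length Ls \<le> length Ks"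
    using nonempty ex_has_least_nat[of "\<lambda>Ls. Ls \<in> D" _ length] by blast
  interpret min_word_system D V adj N m "length Ls"
    by unfold_locales (use Ls no in \<open>auto simp: not_le\<close>)
  show False using not_attained Ls(1) by blast
qed

section \<open>Permutations as families of cycles\<close>

lemma consec_nth: "Suc i < length xs \<Longrightarrow> consec xs (xs ! i) (xs ! Suc i)"
  unfolding consec_def by (metis Cons_nth_drop_Suc Suc_lessD id_take_nth_drop)

lemma consec_distinct_last: "distinct xs \<Longrightarrow> consec xs x y \<Longrightarrow> x \<noteq> last xs"
  unfolding consec_def by (metis distinct.simps(2) distinct_append last.simps last_append last_in_set list.discI)

text \<open>A one-letter word is its own cyclic successor, so fixed points count as cycles, in
  accordance with \<open>orbit\<close>.\<close>

definition cyc :: "('a \<Rightarrow> 'a) \<Rightarrow> 'a list \<Rightarrow> bool" where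
  "cyc f xs \<longleftrightarrow> xs \<noteq> [] \<and> distinct xs \<and> (\<forall>x y. cconsec xs x y \<longrightarrow> f x = y)"

lemma cyc_rotate: "cyc f (P @ Q) \<Longrightarrow> cyc f (Q @ P)"
  by (cases "P = [] \<or> Q = []") (auto simp: cyc_def cconsec_append)

lemma orbit_cyc:
  assumes "cyc f xs" "x \<in> set xs"
  shows "orbit f x = set xs"
proof
  have clos: "f y \<in> set xs" if "y \<in> set xs" for y
  proof -
    obtain A B where AB: "xs = A @ y # B" using \<open>y \<in> set xs\<close> by (auto dest: split_list)
    show ?thesis
    proof (cases B)
      case Nil
      then have "cconsec xs y (hd xs)" using AB by (simp add: cconsec_def)
      then have "f y = hd xs" using assms(1) by (simp add: cyc_def)
      then show ?thesis using AB by (cases A) auto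
    next
      case (Cons z B')
      then have "cconsec xs y z" using AB by (auto simp: cconsec_def consec_def)
      then have "f y = z" using assms(1) by (simp add: cyc_def)
      then show ?thesis using AB Cons by simp
    qed
  qed
  show "orbit f x \<subseteq> set xs"
  proof
    fix y assume "y \<in> orbit f x"
    then show "y \<in> set xs" by induction (use assms(2) clos in auto)
  qed
  obtain A B where AB: "xs = A @ x # B" using assms(2) by (auto dest: split_list)
  let ?ys = "x # B @ A"
  have c: "cyc f ?ys" using assms(1) cyc_rotate[of f A "x # B"] AB by simp
  have step: "?ys ! i \<in> orbit f x" if "0 < i" "i < length ?ys" for i
    using that
  proof (induction i)
    case (Suc i)
    have "cconsec ?ys (?ys ! i) (?ys ! Suc i)" 
      using consec_nth[OF Suc.prems(2)] unfolding cconsec_def by blast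
    then have f: "f (?ys ! i) = ?ys ! Suc i" using c unfolding cyc_def by blast
    show ?case
    proof (cases "i = 0")
      case True
      then show ?thesis using f orbit.base[of f x] by simp
    next
      case False
      then have "?ys ! i \<in> orbit f x" using Suc by simp
      then show ?thesis using f orbit.step by metis
    qed
  qed simp
  have "cconsec ?ys (last ?ys) x" by (simp add: cconsec_def)
  then have fl: "f (last ?ys) = x" using c unfolding cyc_def by blast
  have "x \<in> orbit f x"
  proof (cases "B @ A = []")
    case True
    then show ?thesis using fl orbit.base[of f x] by simp
  next
    case False
    then have l: "0 < length ?ys - 1" "length ?ys - 1 < length ?ys" by simp_all
    have "last ?ys = ?ys ! (length ?ys - 1)" by (rule last_conv_nth) simp
    then have "last ?ys \<in> orbit f x" using step[OF l] by (simp only:)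
    then show ?thesis using fl orbit.step by metis
  qed
  show "set xs \<subseteq> orbit f x"
  proof
    fix y assume "y \<in> set xs"
    then have "y \<in> set ?ys" using AB by auto
    then obtain i where "i < length ?ys" "?ys ! i = y" by (meson in_set_conv_nth)
    then show "y \<in> orbit f x" using step[of i] \<open>x \<in> orbit f x\<close> by (cases i) auto
  qed
qed

lemma cyc_support:
  assumes "f permutes E" "finite E"
  shows "cyc f (support f x)" "set (support f x) = orbit f x"
proof -
  have p: "permutation f" using assms by (auto simp: permutation_permutes)
  let ?n = "least_power f x"
  have n: "(f ^^ ?n) x = x" "?n > 0" using least_power_of_permutation[OF p] by auto
  have len: "length (support f x) = ?n" by simp
  have nth: "support f x ! i = (f ^^ i) x" if "i < ?n" for i using that by simp
  show c: "cyc f (support f x)"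
    unfolding cyc_def
  proof (intro conjI allI impI)
    show "support f x \<noteq> []" using n len by (metis length_0_conv less_irrefl)
    show "distinct (support f x)" using cycle_of_permutation[OF p] .
    fix u v assume "cconsec (support f x) u v"
    then consider A B where "support f x = A @ u # v # B"
      | "last (support f x) = u" "hd (support f x) = v" by (auto simp: cconsec_def consec_def)
    then show "f u = v"
    proof cases
      case 1
      let ?i = "length A"
      have "Suc ?i < ?n" using arg_cong[OF 1, of length] len by simp
      moreover have "u = support f x ! ?i" "v = support f x ! Suc ?i" using 1 by (simp_all add: nth_append)
      ultimately show ?thesis using nth[of ?i] nth[of "Suc ?i"] by simp
    next
      case 2
      have "v = x" using 2 n nth[of 0] by (simp add: hd_conv_nth)
      have "last (support f x) = support f x ! (?n - 1)" using len n(2) by (metis last_conv_nth length_0_conv less_irrefl)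
      then have "u = (f ^^ (?n - 1)) x" using 2 n(2) nth[of "?n - 1"] by simp
      then have "f u = (f ^^ Suc (?n - 1)) x" by simp
      then show ?thesis using n \<open>v = x\<close> by simp
    qed
  qed
  have "support f x ! 0 = x" using nth[of 0] n by simp
  then have "x \<in> set (support f x)" using len n(2) nth_mem by metis
  then show "set (support f x) = orbit f x" using orbit_cyc[OF c] by simp
qed

text \<open>Fixed points of f in E appear as one-letter lists, so the length counts all orbits. The
  order of the cycles and their starting points are left open.\<close>

definition decomp :: "('a \<Rightarrow> 'a) \<Rightarrow> 'a set \<Rightarrow> 'a list list \<Rightarrow> bool" where
  "decomp f E Ls \<longleftrightarrow> distinct (concat Ls) \<and> set (concat Ls) = E \<and> (\<forall>xs \<in> set Ls. cyc f xs)"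

lemma decomp_orbits:
  assumes "decomp f E Ls"
  shows "orbit f ` E = set ` set Ls" "card (orbit f ` E) = length Ls"
proof -
  have d: "distinct (concat Ls)" "E = set (concat Ls)" "\<And>xs. xs \<in> set Ls \<Longrightarrow> cyc f xs"
    using assms by (auto simp: decomp_def)
  have o: "orbit f e = set xs" if "e \<in> set xs" "xs \<in> set Ls" for e xs
    using orbit_cyc d(3) that by metis
  have ne: "xs \<noteq> []" if "xs \<in> set Ls" for xs using d(3)[OF that] by (simp add: cyc_def)
  show *: "orbit f ` E = set ` set Ls"
  proof
    show "orbit f ` E \<subseteq> set ` set Ls" using o d(2) by fastforce
    show "set ` set Ls \<subseteq> orbit f ` E"
    proof
      fix A assume "A \<in> set ` set Ls"
      then obtain xs where xs: "xs \<in> set Ls" "A = set xs" by blast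
      then have "hd xs \<in> set xs" using ne by simp
      then show "A \<in> orbit f ` E" using o[of "hd xs" xs] xs d(2) by (auto simp: rev_image_eqI)
    qed
  qed
  have dL: "distinct Ls" using d(1) ne by (induction Ls) (auto simp: disjoint_iff, metis hd_in_set)
  have "inj_on set (set Ls)"
  proof (rule inj_onI)
    fix xs ys assume a: "xs \<in> set Ls" "ys \<in> set Ls" "set xs = set ys"
    show "xs = ys"
    proof (rule ccontr)
      assume "xs \<noteq> ys"
      then have "set xs \<inter> set ys = {}" using d(1) a(1,2) unfolding distinct_concat_iff by blast
      then show False using a(3) ne[OF a(1)] by simp
    qed
  qed
  then show "card (orbit f ` E) = length Ls"
    unfolding * using dL by (simp add: card_image distinct_card)
qed

lemma decomp_perm: "decomp f E Ls \<Longrightarrow> mset Ls = mset Ls' \<Longrightarrow> decomp f E Ls'"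
proof -
  assume d: "decomp f E Ls" "mset Ls = mset Ls'"
  have "mset (concat Ls) = mset (concat Ls')"
    using d(2) by (metis mset_concat mset_map sum_mset_sum_list)
  then have "distinct (concat Ls')" "set (concat Ls') = set (concat Ls)"
    using d(1) unfolding decomp_def by (metis mset_eq_imp_distinct_iff, metis mset_eq_setD)
  then show ?thesis using d mset_eq_setD[OF d(2)] unfolding decomp_def by auto
qed

lemma decomp_exists:
  assumes "f permutes E" "finite E"
  shows "\<exists>Ls. decomp f E Ls"
proof -
  have p: "permutation f" using assms by (auto simp: permutation_permutes)
  obtain os where os: "set os = orbit f ` E" "distinct os" 
    using finite_distinct_list[OF finite_imageI[OF assms(2)]] by metis
  have "\<forall>F \<in> orbit f ` E. \<exists>xs. cyc f xs \<and> set xs = F" using cyc_support[OF assms] by blast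
  then obtain w where w: "\<And>F. F \<in> orbit f ` E \<Longrightarrow> cyc f (w F) \<and> set (w F) = F" by metis
  have "decomp f E (map w os)"
    unfolding decomp_def
  proof (intro conjI ballI)
    show "distinct (concat (map w os))"
    proof (rule distinct_concat)
      have "inj_on w (set os)" using w os(1) by (metis inj_onI)
      then show "distinct (map w os)" using os(2) by (simp add: distinct_map)
      show "distinct ys" if "ys \<in> set (map w os)" for ys using that w os by (auto simp: cyc_def)
      show "set ys \<inter> set zs = {}" if yz: "ys \<in> set (map w os)" "zs \<in> set (map w os)" "ys \<noteq> zs" for ys zs
      proof (rule ccontr)
        assume "set ys \<inter> set zs \<noteq> {}"
        then obtain x where x: "x \<in> set ys" "x \<in> set zs" by blast
        obtain F F' where F: "F \<in> orbit f ` E" "F' \<in> orbit f ` E" "ys = w F" "zs = w F'"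
          using yz(1,2) unfolding set_map os(1) by blast
        have "orbit f x = F" using x(1) w[OF F(1)] orbit_cyc F(3) by metis
        moreover have "orbit f x = F'" using x(2) w[OF F(2)] orbit_cyc F(4) by metis
        ultimately show False using F yz(3) by simp
      qed
    qed
    have "x \<in> orbit f x" for x using permutation_self_in_orbit[OF p] .
    moreover have "orbit f x \<subseteq> E" if "x \<in> E" for x using permutes_orbit_subset[OF assms(1) that] .
    ultimately have "\<Union> (orbit f ` E) = E" by blast
    then show "set (concat (map w os)) = E" using w os(1) by simp
    show "cyc f xs" if "xs \<in> set (map w os)" for xs using that w os by auto
  qed
  then show ?thesis by blast
qed

section \<open>Multiplying by a 3-cycle: merging, transferring and splitting cycles\<close>

definition cycle3 :: "'a \<Rightarrow> 'a \<Rightarrow> 'a \<Rightarrow> 'a \<Rightarrow> 'a" where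
  "cycle3 a b c x = (if x = a then b else if x = b then c else if x = c then a else x)"

lemma cyc_cong:
  assumes "cyc f xs" "\<And>x. x \<in> set xs \<Longrightarrow> g x = f x"
  shows "cyc g xs"
  using assms cconsec_in_set unfolding cyc_def by metis

lemma cyc_cycle3_other:
  assumes "cyc f W" "a \<notin> set W" "b \<notin> set W" "c \<notin> set W"
  shows "cyc (f \<circ> cycle3 a b c) W"
  by (rule cyc_cong[OF assms(1)]) (use assms in \<open>auto simp: cycle3_def\<close>)

lemma cconsec1: "X \<noteq> [] \<Longrightarrow> cconsec X x y \<longleftrightarrow> consec X x y \<or> (x = last X \<and> y = hd X)"
  by (auto simp: cconsec_def)

lemma cconsec2:
  "X \<noteq> [] \<Longrightarrow> Y \<noteq> [] \<Longrightarrow> cconsec (X @ Y) x y \<longleftrightarrow>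
    consec X x y \<or> consec Y x y \<or> (x = last X \<and> y = hd Y) \<or> (x = last Y \<and> y = hd X)"
  by (auto simp: cconsec_append)

lemma cconsec3:
  "X \<noteq> [] \<Longrightarrow> Y \<noteq> [] \<Longrightarrow> Z \<noteq> [] \<Longrightarrow> cconsec (X @ Y @ Z) x y \<longleftrightarrow>
    consec X x y \<or> consec Y x y \<or> consec Z x y \<or>
    (x = last X \<and> y = hd Y) \<or> (x = last Y \<and> y = hd Z) \<or> (x = last Z \<and> y = hd X)"
  by (auto simp: cconsec_append consec_append)

text \<open>Cutting a cycle into \<open>linked\<close> segments isolates the transitions at their
  ends, which are all that a 3-cycle on the end points changes.\<close>

definition linked :: "('a \<Rightarrow> 'a) \<Rightarrow> 'a list \<Rightarrow> bool" where
  "linked f xs \<longleftrightarrow> (\<forall>x y. consec xs x y \<longrightarrow> f x = y)"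

lemma cyc1: "X \<noteq> [] \<Longrightarrow> cyc f X \<longleftrightarrow> distinct X \<and> linked f X \<and> f (last X) = hd X"
  unfolding cyc_def linked_def by (auto simp: cconsec1)

lemma cyc2:
  "X \<noteq> [] \<Longrightarrow> Y \<noteq> [] \<Longrightarrow> cyc f (X @ Y) \<longleftrightarrow>
    distinct (X @ Y) \<and> linked f X \<and> linked f Y \<and> f (last X) = hd Y \<and> f (last Y) = hd X"
  unfolding cyc_def linked_def by (auto simp: cconsec2)

lemma cyc3:
  "X \<noteq> [] \<Longrightarrow> Y \<noteq> [] \<Longrightarrow> Z \<noteq> [] \<Longrightarrow> cyc f (X @ Y @ Z) \<longleftrightarrow>
    distinct (X @ Y @ Z) \<and> linked f X \<and> linked f Y \<and> linked f Z \<and>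
    f (last X) = hd Y \<and> f (last Y) = hd Z \<and> f (last Z) = hd X"
  unfolding cyc_def linked_def by (auto simp: cconsec3)

context
  fixes f :: "'a \<Rightarrow> 'a" and X Y Z :: "'a list" and a b c :: 'a
  assumes X: "X \<noteq> []" "last X = a" and Y: "Y \<noteq> []" "last Y = b" and Z: "Z \<noteq> []" "last Z = c"
    and dist: "distinct (X @ Y @ Z)"
begin

lemma ends_mem: "a \<in> set X" "b \<in> set Y" "c \<in> set Z"
  using X Y Z by auto

lemma parts_disjoint: "set X \<inter> set Y = {}" "set X \<inter> set Z = {}" "set Y \<inter> set Z = {}"
  using dist by auto

lemma ends_distinct: "a \<noteq> b" "a \<noteq> c" "b \<noteq> c"
  using ends_mem parts_disjoint by blast+

lemma consec_cycle3:
  assumes "consec X x y \<or> consec Y x y \<or> consec Z x y"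
  shows "cycle3 a b c x = x" "cycle3 a c b x = x"
proof -
  have "(x \<in> set X \<and> x \<noteq> a) \<or> (x \<in> set Y \<and> x \<noteq> b) \<or> (x \<in> set Z \<and> x \<noteq> c)"
    using assms consec_distinct_last[of X x y] consec_distinct_last[of Y x y]
      consec_distinct_last[of Z x y] consec_in_set[of _ x y] dist X(2) Y(2) Z(2) by auto
  then have "x \<noteq> a \<and> x \<noteq> b \<and> x \<noteq> c"
    using ends_mem parts_disjoint by blast
  then show "cycle3 a b c x = x" "cycle3 a c b x = x" by (auto simp: cycle3_def)
qed

lemma cycle3_at:
  "cycle3 a b c a = b" "cycle3 a b c b = c" "cycle3 a b c c = a"
  "cycle3 a c b a = c" "cycle3 a c b c = b" "cycle3 a c b b = a"
  using ends_distinct by (auto simp: cycle3_def)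

lemma linked_cycle3:
  assumes "W \<in> {X, Y, Z}" "linked f W"
  shows "linked (f \<circ> cycle3 a b c) W" "linked (f \<circ> cycle3 a c b) W"
proof -
  have "cycle3 a b c x = x" "cycle3 a c b x = x" if "consec W x y" for x y
    using consec_cycle3[of x y] assms(1) that by auto
  then show "linked (f \<circ> cycle3 a b c) W" "linked (f \<circ> cycle3 a c b) W"
    using assms(2) unfolding linked_def comp_def by metis+
qed

text \<open>The product sends a where f sends b, b where f sends c, and c where f sends a, so each
  segment is now followed by the next one.\<close>

lemma cyc_merge:
  assumes "cyc f X" "cyc f Y" "cyc f Z"
  shows "cyc (f \<circ> cycle3 a b c) (X @ Y @ Z)"
  using assms linked_cycle3(1) cycle3_at dist X(2) Y(2) Z(2)
  unfolding cyc1[OF X(1)] cyc1[OF Y(1)] cyc1[OF Z(1)] cyc3[OF X(1) Y(1) Z(1)] by simp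

lemma cyc_transfer:
  assumes "cyc f (X @ Y)" "cyc f Z"
  shows "cyc (f \<circ> cycle3 a b c) X" "cyc (f \<circ> cycle3 a b c) (Y @ Z)"
  using assms linked_cycle3(1) cycle3_at dist X(2) Y(2) Z(2)
  unfolding cyc2[OF X(1) Y(1)] cyc1[OF Z(1)] cyc1[OF X(1)] cyc2[OF Y(1) Z(1)] by simp_all

text \<open>The two 3-cycles are mutually inverse: one leads from X to Z, from Z to Y and back to X,
  while the other closes each segment on itself.\<close>

lemma cyc_split:
  assumes "cyc f (X @ Y @ Z)"
  shows "cyc (f \<circ> cycle3 a b c) (X @ Z @ Y)" "cyc (f \<circ> cycle3 a c b) X"
    "cyc (f \<circ> cycle3 a c b) Y" "cyc (f \<circ> cycle3 a c b) Z"
  using assms linked_cycle3 cycle3_at dist X(2) Y(2) Z(2)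
  unfolding cyc3[OF X(1) Y(1) Z(1)] cyc3[OF X(1) Z(1) Y(1)] cyc1[OF X(1)] cyc1[OF Y(1)] cyc1[OF Z(1)]
  by (simp_all add: Int_commute Un_commute)

end

section \<open>Parity and the number of orbits\<close>

lemma consec_butlast: "consec xs x y \<Longrightarrow> x \<in> set (butlast xs)"
  by (auto simp: consec_def butlast_append)

lemma linked_cong: "linked f W \<Longrightarrow> (\<And>x. x \<in> set (butlast W) \<Longrightarrow> g x = f x) \<Longrightarrow> linked g W"
  unfolding linked_def using consec_butlast by metis

lemma decomp_focus:
  assumes "decomp f E Ls" "a \<in> E"
  obtains X R where "decomp f E ((X @ [a]) # R)"
proof -
  obtain xs where xs: "xs \<in> set Ls" "a \<in> set xs" using assms by (auto simp: decomp_def)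
  obtain L1 L2 where L: "Ls = L1 @ xs # L2" using xs(1) by (auto dest: split_list)
  obtain A B where AB: "xs = A @ a # B" using xs(2) by (auto dest: split_list)
  have "decomp f E (xs # L1 @ L2)" by (rule decomp_perm[OF assms(1)]) (simp add: L)
  moreover have "cyc f xs \<Longrightarrow> cyc f ((B @ A) @ [a])" using cyc_rotate[of f "A @ [a]" B] AB by simp
  ultimately have "decomp f E (((B @ A) @ [a]) # L1 @ L2)" using AB by (auto simp: decomp_def)
  then show thesis by (rule that)
qed

text \<open>If a and b share a cycle, the product splits it in two; otherwise it joins their cycles.
  Either way the count changes by one.\<close>

lemma orbits_transpose:
  assumes f: "f permutes E" "finite E" and ab: "a \<in> E" "b \<in> E" "a \<noteq> b"
  shows "odd (card (orbit (f \<circ> transpose a b) ` E) + card (orbit f ` E))"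
proof -
  define g where "g = f \<circ> transpose a b"
  obtain Ls where "decomp f E Ls" using decomp_exists[OF f] by blast
  then obtain W R where d: "decomp f E ((W @ [a]) # R)" using decomp_focus ab(1) by metis
  have cong: "g x = f x" if "x \<noteq> a" "x \<noteq> b" for x using that by (simp add: g_def transpose_def)
  have gab: "g a = f b" "g b = f a" by (simp_all add: g_def)
  have "odd (card (orbit g ` E) + card (orbit f ` E))"
  proof (cases "b \<in> set W")
    case True
    then obtain P Q where W: "W = P @ b # Q" by (auto dest: split_list)
    let ?X = "P @ [b]" and ?Y = "Q @ [a]"
    have d': "decomp f E ((?X @ ?Y) # R)" using d W by simp
    then have c: "cyc f (?X @ ?Y)" and R: "\<forall>V \<in> set R. cyc f V"
      and dist: "distinct (concat ((?X @ ?Y) # R))" "set (concat ((?X @ ?Y) # R)) = E"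
      unfolding decomp_def by auto
    have l: "linked f ?X" "linked f ?Y" "f b = hd ?Y" "f a = hd ?X" using c cyc2[of ?X ?Y f] by auto
    have nb: "a \<notin> set P" "b \<notin> set P" "a \<notin> set Q" "b \<notin> set Q" using dist(1) by auto
    have lg: "linked g ?X" "linked g ?Y"
      by (rule linked_cong[OF l(1)], rule cong; use nb in \<open>auto simp: butlast_append\<close>)
        (rule linked_cong[OF l(2)], rule cong; use nb in \<open>auto simp: butlast_append\<close>)
    have dXY: "distinct ?X" "distinct ?Y" using dist(1) by auto
    have "cyc g ?X" "cyc g ?Y"
      using cyc1[of ?X g] cyc1[of ?Y g] lg dXY l(3,4) gab by simp_all
    moreover have "cyc g V" if V: "V \<in> set R" for V
    proof (rule cyc_cong)
      show "cyc f V" using R V by blast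
      have "a \<notin> set V" "b \<notin> set V" using V dist(1) by auto
      then show "g x = f x" if "x \<in> set V" for x using cong[of x] that by blast
    qed
    ultimately have "decomp g E (?X # ?Y # R)" using dist unfolding decomp_def by auto
    then show ?thesis using decomp_orbits(2)[OF d'] decomp_orbits(2)[of g E] by simp
  next
    case False
    obtain ys where ys: "ys \<in> set R" "b \<in> set ys" using d ab False by (auto simp: decomp_def)
    obtain R1 R2 where R: "R = R1 @ ys # R2" using ys(1) by (auto dest: split_list)
    obtain A B where AB: "ys = A @ b # B" using ys(2) by (auto dest: split_list)
    let ?X = "W @ [a]" and ?Y = "(B @ A) @ [b]" and ?R = "R1 @ R2"
    have "decomp f E (?X # ys # ?R)" by (rule decomp_perm[OF d]) (simp add: R)
    moreover have "cyc f ys \<Longrightarrow> cyc f ?Y" using cyc_rotate[of f "A @ [b]" B] AB by simp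
    ultimately have d': "decomp f E (?X # ?Y # ?R)" using AB by (auto simp: decomp_def)
    then have c: "cyc f ?X" "cyc f ?Y" and R: "\<forall>V \<in> set ?R. cyc f V"
      and dist: "distinct (concat (?X # ?Y # ?R))" "set (concat (?X # ?Y # ?R)) = E"
      unfolding decomp_def by auto
    have l: "linked f ?X" "linked f ?Y" "f b = hd ?Y" "f a = hd ?X"
      using c cyc1[of ?X f] cyc1[of ?Y f] by auto
    have nb: "a \<notin> set W" "b \<notin> set W" "a \<notin> set (B @ A)" "b \<notin> set (B @ A)"
      and dXY: "distinct (?X @ ?Y)" using dist(1) by auto
    have lg: "linked g ?X" "linked g ?Y"
      by (rule linked_cong[OF l(1)], rule cong; use nb in \<open>auto simp: butlast_append\<close>)
        (rule linked_cong[OF l(2)], rule cong; use nb in \<open>auto simp: butlast_append\<close>)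
    have "cyc g (?X @ ?Y)"
      using cyc2[of ?X ?Y g] lg l(3,4) gab dXY by (simp del: append_assoc distinct_append)
    moreover have "cyc g V" if V: "V \<in> set ?R" for V
    proof (rule cyc_cong)
      show "cyc f V" using R V by blast
      have "a \<notin> set V" "b \<notin> set V" using V dist(1) by auto
      then show "g x = f x" if "x \<in> set V" for x using cong[of x] that by blast
    qed
    ultimately have "decomp g E ((?X @ ?Y) # ?R)" using dist unfolding decomp_def by auto
    then show ?thesis using decomp_orbits(2)[OF d'] decomp_orbits(2)[of g E] by simp
  qed
  then show ?thesis unfolding g_def .
qed

text \<open>Each transposition flips the sign and, by \<open>orbits_transpose\<close>, the parity of
  the orbit count, while the identity has \<open>card E\<close> orbits.\<close>

lemma evenperm_iff_orbits:
  assumes "f permutes E" "finite E"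
  shows "evenperm f \<longleftrightarrow> even (card E + card (orbit f ` E))"
  using assms(2,1)
proof (induction rule: permutes_rev_induct)
  case id
  have "orbit id x = {x}" for x :: 'a by (simp add: orbit_eq_singleton_iff)
  then have "orbit id ` E = (\<lambda>x. {x}) ` E" by simp
  then have c: "card (orbit id ` E) = card E" by (simp add: card_image)
  show ?case unfolding c by simp
next
  case (swap a b p)
  have "permutation p" using swap assms(2) by (auto simp: permutation_permutes)
  then have "evenperm (p \<circ> transpose a b) \<longleftrightarrow> \<not> evenperm p"
    using swap by (simp add: evenperm_comp permutation_swap_id evenperm_swap)
  moreover have "odd (card (orbit (p \<circ> transpose a b) ` E) + card (orbit p ` E))"
    using swap.hyps assms(2) by (intro orbits_transpose) simp_all
  ultimately show ?case using swap.IH by (simp only: even_add) blast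
qed

section \<open>The word system of the other faces\<close>

text \<open>S stands for all products of the circuit successor with an admissible rotation, and h
  for the head map. Only one of the two 3-cycles is guaranteed to stay in S, because the other may
  break up the cycle at a vertex.\<close>

locale face_perms =
  fixes E :: "'e set" and S :: "('e \<Rightarrow> 'e) set" and h :: "'e \<Rightarrow> 'v"
    and V :: "'v set" and adj :: "'v \<Rightarrow> 'v \<Rightarrow> bool" and N :: nat
  assumes S_nonempty: "S \<noteq> {}" and finite_E: "finite E" and h_V: "h ` E \<subseteq> V"
    and S_permutes: "f \<in> S \<Longrightarrow> f permutes E"
    and S_cycle3: "f \<in> S \<Longrightarrow> a \<in> E \<Longrightarrow> b \<in> E \<Longrightarrow> c \<in> E \<Longrightarrow> a \<noteq> b \<Longrightarrow> a \<noteq> c \<Longrightarrow> b \<noteq> c \<Longrightarrow>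
      h a = h b \<Longrightarrow> h b = h c \<Longrightarrow> f \<circ> cycle3 a b c \<in> S \<or> f \<circ> cycle3 a c b \<in> S"
    and S_adj: "f \<in> S \<Longrightarrow> adj x y \<Longrightarrow>
      \<exists>e \<in> E. (h e = x \<and> h (f e) = y) \<or> (h e = y \<and> h (f e) = x)"
    and adj_sym: "adj x y \<Longrightarrow> adj y x"
    and finite_V: "finite V"
    and dense: "x \<in> V \<Longrightarrow> card {y \<in> V. y \<noteq> x \<and> \<not> adj x y} \<le> N"
    and large: "5 * N + 7 \<le> card V"
begin

definition D :: "'v list list set" where
  "D = {map (map h) Ls | f Ls. f \<in> S \<and> decomp f E Ls}"

lemma D_I: "f \<in> S \<Longrightarrow> decomp f E Ls \<Longrightarrow> map (map h) Ls = Ks \<Longrightarrow> Ks \<in> D"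
  by (auto simp: D_def)

lemma ends_at_map: "ends_at u (map h X) \<longleftrightarrow> X \<noteq> [] \<and> h (last X) = u"
  by (auto simp: ends_at_def last_map)

text \<open>The cycles in R avoid the three end points, so they survive whichever 3-cycle keeps the
  product in S.\<close>

lemma surgery:
  assumes f: "f \<in> S" and d: "distinct (X @ Y @ Z @ concat R)" "set (X @ Y @ Z @ concat R) = E"
    and R: "\<forall>W \<in> set R. cyc f W" and ne: "X \<noteq> []" "Y \<noteq> []" "Z \<noteq> []"
    and u: "h (last X) = u" "h (last Y) = u" "h (last Z) = u"
  shows "(f \<circ> cycle3 (last X) (last Y) (last Z) \<in> S \<and>
       (\<forall>W \<in> set R. cyc (f \<circ> cycle3 (last X) (last Y) (last Z)) W)) \<or>
     (f \<circ> cycle3 (last X) (last Z) (last Y) \<in> S \<and>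
       (\<forall>W \<in> set R. cyc (f \<circ> cycle3 (last X) (last Z) (last Y)) W))"
proof -
  have mem: "last X \<in> set X" "last Y \<in> set Y" "last Z \<in> set Z" using ne by auto
  then have notR: "last X \<notin> set (concat R)" "last Y \<notin> set (concat R)" "last Z \<notin> set (concat R)"
    using d(1) by auto
  have E: "last X \<in> E" "last Y \<in> E" "last Z \<in> E" using mem d(2) by auto
  have "last X \<noteq> last Y" "last X \<noteq> last Z" "last Y \<noteq> last Z" using mem d(1) by auto
  then have "f \<circ> cycle3 (last X) (last Y) (last Z) \<in> S \<or> f \<circ> cycle3 (last X) (last Z) (last Y) \<in> S"
    using S_cycle3[OF f E] u by simp
  moreover have "last X \<notin> set W" "last Y \<notin> set W" "last Z \<notin> set W" if "W \<in> set R" for W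
    using notR that by auto
  ultimately show ?thesis using R cyc_cycle3_other by meson
qed

sublocale word_system D V adj N "card E"
proof
  obtain f where f: "f \<in> S" using S_nonempty by blast
  obtain Ls where "decomp f E Ls" using decomp_exists[OF S_permutes[OF f] finite_E] by blast
  then show "D \<noteq> {}" using f by (auto simp: D_def)
next
  fix Ks assume "Ks \<in> D"
  then obtain f Ls where L: "f \<in> S" "decomp f E Ls" "Ks = map (map h) Ls" by (auto simp: D_def)
  then show "[] \<notin> set Ks" by (auto simp: decomp_def cyc_def)
  have c: "concat Ks = map h (concat Ls)" using L(3) by (simp add: map_concat)
  have "length (concat Ls) = card E" using L(2) distinct_card[of "concat Ls"] by (simp add: decomp_def)
  then show "length (concat Ks) = card E" using c by simp
  have "set (concat Ks) \<subseteq> V" using c L(2) h_V by (auto simp: decomp_def)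
  then show "set xs \<subseteq> V" if "xs \<in> set Ks" for xs using that by auto
  show "Ks' \<in> D" if "mset Ks = mset Ks'" for Ks'
  proof -
    \<comment> \<open>The reordering of the head words is lifted to the underlying arc cycles, which
      again form a decomposition for the same f.\<close>
    have "list_all2 (\<lambda>y x. y = map h x) Ks Ls" using L(3) by (simp add: list_all2_conv_all_nth)
    from list_all2_reorder_left_invariance[OF this that[symmetric]]
    obtain Ls' where L': "list_all2 (\<lambda>y x. y = map h x) Ks' Ls'" "mset Ls' = mset Ls" by blast
    have "Ks' = map (map h) Ls'" using L'(1) by (auto simp: list_all2_conv_all_nth intro: nth_equalityI)
    then show ?thesis using D_I[OF L(1) decomp_perm[OF L(2)]] L'(2) by metis
  qed
  show "\<exists>xs \<in> set Ks. cconsec xs x y \<or> cconsec xs y x" if xy: "adj x y" for x y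
  proof -
    obtain e where e: "e \<in> E" "(h e = x \<and> h (f e) = y) \<or> (h e = y \<and> h (f e) = x)"
      using S_adj[OF L(1) xy] by blast
    obtain xs where xs: "xs \<in> set Ls" "e \<in> set xs" "cyc f xs" using e(1) L(2) by (auto simp: decomp_def)
    have "cconsec (map h xs) (h e) (h (f e))"
    proof -
      obtain A B where AB: "xs = A @ e # B" using xs(2) by (auto dest: split_list)
      show ?thesis
      proof (cases B)
        case Nil
        then have "cconsec xs e (hd xs)" using AB by (simp add: cconsec_def)
        then have "f e = hd xs" using xs(3) by (simp add: cyc_def)
        then show ?thesis using AB Nil by (cases A) (auto simp: cconsec_def)
      next
        case (Cons z B')
        then have "cconsec xs e z" using AB by (auto simp: cconsec_def consec_def)
        then have "f e = z" using xs(3) by (simp add: cyc_def)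
        then have "map h xs = map h A @ h e # h (f e) # map h B'" using AB Cons by simp
        then show ?thesis unfolding cconsec_def consec_def by blast
      qed
    qed
    then show ?thesis using e(2) xs(1) L(3) by auto
  qed
next
  fix xs ys R assume "(xs @ ys) # R \<in> D"
  then obtain f Ls where L: "f \<in> S" "decomp f E Ls" "(xs @ ys) # R = map (map h) Ls" by (auto simp: D_def)
  then obtain X Y Rs where XY: "Ls = (X @ Y) # Rs" "xs = map h X" "ys = map h Y" "R = map (map h) Rs"
    by (auto simp: Cons_eq_map_conv append_eq_map_conv)
  have "decomp f E ((Y @ X) # Rs)" using L(2) XY(1) cyc_rotate[of f X Y] by (auto simp: decomp_def)
  then show "(ys @ xs) # R \<in> D" using D_I[OF L(1)] XY by simp
next
  fix X Y Z R u assume a: "X # Y # Z # R \<in> D" "ends_at u X" "ends_at u Y" "ends_at u Z"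
  then obtain f Ls where L: "f \<in> S" "decomp f E Ls" "X # Y # Z # R = map (map h) Ls" by (auto simp: D_def)
  then obtain A B C Rs where XY: "Ls = A # B # C # Rs" "X = map h A" "Y = map h B" "Z = map h C" "R = map (map h) Rs"
    by (auto simp: Cons_eq_map_conv)
  have d: "distinct (A @ B @ C @ concat Rs)" "set (A @ B @ C @ concat Rs) = E"
    "cyc f A" "cyc f B" "cyc f C" "\<forall>W \<in> set Rs. cyc f W" using L(2) XY(1) by (auto simp: decomp_def)
  have ends: "A \<noteq> []" "h (last A) = u" "B \<noteq> []" "h (last B) = u" "C \<noteq> []" "h (last C) = u"
    using a(2-4) XY ends_at_map by auto
  have dd: "distinct (A @ B @ C)" "distinct (A @ C @ B)" using d(1) by auto
  note m1 = cyc_merge[OF ends(1) refl ends(3) refl ends(5) refl dd(1) d(3,4,5)]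
  note m2 = cyc_merge[OF ends(1) refl ends(5) refl ends(3) refl dd(2) d(3,5,4)]
  from surgery[OF L(1) d(1,2,6) ends(1,3,5) ends(2,4,6)]
  show "(X @ Y @ Z) # R \<in> D \<or> (X @ Z @ Y) # R \<in> D"
  proof
    assume s: "f \<circ> cycle3 (last A) (last B) (last C) \<in> S \<and> 
      (\<forall>W \<in> set Rs. cyc (f \<circ> cycle3 (last A) (last B) (last C)) W)"
    then have "decomp (f \<circ> cycle3 (last A) (last B) (last C)) E ((A @ B @ C) # Rs)"
      using m1 d(1,2) by (auto simp: decomp_def)
    then show ?thesis using D_I[of "f \<circ> cycle3 (last A) (last B) (last C)"] s XY by auto
  next
    assume s: "f \<circ> cycle3 (last A) (last C) (last B) \<in> S \<and> 
      (\<forall>W \<in> set Rs. cyc (f \<circ> cycle3 (last A) (last C) (last B)) W)"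
    then have "decomp (f \<circ> cycle3 (last A) (last C) (last B)) E ((A @ C @ B) # Rs)"
      using m2 d(1,2) by (auto simp: decomp_def)
    then show ?thesis using D_I[of "f \<circ> cycle3 (last A) (last C) (last B)"] s XY by auto
  qed
next
  fix X Y Z R u assume a: "(X @ Y) # Z # R \<in> D" "ends_at u X" "ends_at u Y" "ends_at u Z"
  then obtain f Ls where L: "f \<in> S" "decomp f E Ls" "(X @ Y) # Z # R = map (map h) Ls" by (auto simp: D_def)
  then obtain A B C Rs where XY: "Ls = (A @ B) # C # Rs" "X = map h A" "Y = map h B" "Z = map h C" "R = map (map h) Rs"
    by (auto simp: Cons_eq_map_conv append_eq_map_conv)
  have d: "distinct (A @ B @ C @ concat Rs)" "set (A @ B @ C @ concat Rs) = E"
    "cyc f (A @ B)" "cyc f (B @ A)" "cyc f C" "\<forall>W \<in> set Rs. cyc f W"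
    using L(2) XY(1) cyc_rotate[of f A B] by (auto simp: decomp_def)
  have ends: "A \<noteq> []" "h (last A) = u" "B \<noteq> []" "h (last B) = u" "C \<noteq> []" "h (last C) = u"
    using a(2-4) XY ends_at_map by auto
  have dd: "distinct (A @ B @ C)" "distinct (B @ A @ C)" using d(1) by auto
  \<comment> \<open>The second outcome is \<open>cyc_transfer\<close> with the two segments
    exchanged, which uses the inverse 3-cycle.\<close>
  have c3: "cycle3 (last B) (last A) (last C) = cycle3 (last A) (last C) (last B)"
    using ends_distinct[OF ends(1) refl ends(3) refl ends(5) refl dd(1)] by (auto simp: cycle3_def fun_eq_iff)
  note m1 = cyc_transfer[OF ends(1) refl ends(3) refl ends(5) refl dd(1) d(3,5)]
  note m2 = cyc_transfer[OF ends(3) refl ends(1) refl ends(5) refl dd(2) d(4,5), unfolded c3]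
  from surgery[OF L(1) d(1,2,6) ends(1,3,5) ends(2,4,6)]
  show "X # (Y @ Z) # R \<in> D \<or> Y # (X @ Z) # R \<in> D"
  proof
    assume s: "f \<circ> cycle3 (last A) (last B) (last C) \<in> S \<and> 
      (\<forall>W \<in> set Rs. cyc (f \<circ> cycle3 (last A) (last B) (last C)) W)"
    then have "decomp (f \<circ> cycle3 (last A) (last B) (last C)) E (A # (B @ C) # Rs)"
      using m1 d(1,2) by (auto simp: decomp_def)
    then show ?thesis using D_I[of "f \<circ> cycle3 (last A) (last B) (last C)"] s XY by auto
  next
    assume s: "f \<circ> cycle3 (last A) (last C) (last B) \<in> S \<and> 
      (\<forall>W \<in> set Rs. cyc (f \<circ> cycle3 (last A) (last C) (last B)) W)"
    then have "decomp (f \<circ> cycle3 (last A) (last C) (last B)) E (B # (A @ C) # Rs)"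
      using m2 d(1,2) by (auto simp: decomp_def)
    then show ?thesis using D_I[of "f \<circ> cycle3 (last A) (last C) (last B)"] s XY by auto
  qed
next
  fix X Y Z R u assume a: "(X @ Y @ Z) # R \<in> D" "ends_at u X" "ends_at u Y" "ends_at u Z"
  then obtain f Ls where L: "f \<in> S" "decomp f E Ls" "(X @ Y @ Z) # R = map (map h) Ls" by (auto simp: D_def)
  then obtain A B C Rs where XY: "Ls = (A @ B @ C) # Rs" "X = map h A" "Y = map h B" "Z = map h C" "R = map (map h) Rs"
    by (auto simp: Cons_eq_map_conv append_eq_map_conv)
  have d: "distinct (A @ B @ C @ concat Rs)" "set (A @ B @ C @ concat Rs) = E"
    "cyc f (A @ B @ C)" "\<forall>W \<in> set Rs. cyc f W"
    using L(2) XY(1) by (auto simp: decomp_def)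
  have ends: "A \<noteq> []" "h (last A) = u" "B \<noteq> []" "h (last B) = u" "C \<noteq> []" "h (last C) = u"
    using a(2-4) XY ends_at_map by auto
  have dd: "distinct (A @ B @ C)" using d(1) by auto
  note m = cyc_split[OF ends(1) refl ends(3) refl ends(5) refl dd(1) d(3)]
  from surgery[OF L(1) d(1,2,4) ends(1,3,5) ends(2,4,6)]
  show "(X @ Z @ Y) # R \<in> D \<or> X # Y # Z # R \<in> D"
  proof
    assume s: "f \<circ> cycle3 (last A) (last B) (last C) \<in> S \<and> 
      (\<forall>W \<in> set Rs. cyc (f \<circ> cycle3 (last A) (last B) (last C)) W)"
    then have "decomp (f \<circ> cycle3 (last A) (last B) (last C)) E ((A @ C @ B) # Rs)"
      using m d(1,2) by (auto simp: decomp_def)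
    then show ?thesis using D_I[of "f \<circ> cycle3 (last A) (last B) (last C)"] s XY by auto
  next
    assume s: "f \<circ> cycle3 (last A) (last C) (last B) \<in> S \<and> 
      (\<forall>W \<in> set Rs. cyc (f \<circ> cycle3 (last A) (last C) (last B)) W)"
    then have "decomp (f \<circ> cycle3 (last A) (last C) (last B)) E (A # B # C # Rs)"
      using m d(1,2) by (auto simp: decomp_def)
    then show ?thesis using D_I[of "f \<circ> cycle3 (last A) (last C) (last B)"] s XY by auto
  qed
qed (use adj_sym finite_V dense large in auto)

end

section \<open>Permutations with prescribed cycles, and conjugation of orbits\<close>

lemma cyc_cycle_of_list:
  assumes "distinct xs" "xs \<noteq> []"
  shows "cyc (cycle_of_list xs) xs"
proof -
  let ?f = "cycle_of_list xs"
  have m: "map ?f xs = rotate1 xs" using cyclic_rotation[OF assms(1), of 1] by simp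
  have r: "rotate1 xs = tl xs @ [hd xs]" using assms(2) by (cases xs) auto
  have "?f x = y" if "cconsec xs x y" for x y
  proof -
    consider A B where "xs = A @ x # y # B" | "last xs = x" "hd xs = y"
      using \<open>cconsec xs x y\<close> by (auto simp: cconsec_def consec_def)
    then show ?thesis
    proof cases
      case 1
      have "length A < length xs" "xs ! length A = x" using 1 by simp_all
      then have "?f x = map ?f xs ! length A" by simp
      also have "\<dots> = (tl xs @ [hd xs]) ! length A" using m r by simp
      also have "\<dots> = y" using 1 by (cases A) (auto simp: nth_append)
      finally show ?thesis .
    next
      case 2
      have "?f x = last (map ?f xs)" using 2 assms(2) by (simp add: last_map)
      then show ?thesis using m r 2 by simp
    qed
  qed
  then show ?thesis using assms by (simp add: cyc_def)
qed

lemma permutation_from_cycles: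
  assumes "distinct (concat Ws)" "[] \<notin> set Ws"
  shows "\<exists>f. f permutes set (concat Ws) \<and> decomp f (set (concat Ws)) Ws"
  using assms
proof (induction Ws)
  case Nil
  show ?case by (auto intro!: exI[of _ id] simp: decomp_def permutes_id)
next
  case (Cons xs Ws)
  then obtain f where f: "f permutes set (concat Ws)" "decomp f (set (concat Ws)) Ws" by auto
  let ?g = "cycle_of_list xs"
  have d: "distinct xs" "xs \<noteq> []" "set xs \<inter> set (concat Ws) = {}" using Cons.prems by auto
  have g: "?g permutes set xs" by (rule cycle_permutes)
  have "?g \<circ> f permutes set (concat (xs # Ws))"
    by (rule permutes_compose; rule permutes_subset[OF f(1)] permutes_subset[OF g]) auto
  moreover have "cyc (?g \<circ> f) xs"
  proof (rule cyc_cong[OF cyc_cycle_of_list[OF d(1,2)]])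
    fix x assume "x \<in> set xs"
    then have "f x = x" using d(3) permutes_not_in[OF f(1)] by blast
    then show "(?g \<circ> f) x = ?g x" by simp
  qed
  moreover have "cyc (?g \<circ> f) W" if W: "W \<in> set Ws" for W
  proof (rule cyc_cong)
    show "cyc f W" using f(2) W by (simp add: decomp_def)
    fix x assume "x \<in> set W"
    then have "f x \<in> set (concat Ws)" using W permutes_in_image[OF f(1), of x] by auto
    then have "f x \<notin> set xs" using d(3) by blast
    then show "(?g \<circ> f) x = f x" using permutes_not_in[OF g] by simp
  qed
  ultimately have "decomp (?g \<circ> f) (set (concat (xs # Ws))) (xs # Ws)"
    using Cons.prems(1) unfolding decomp_def by simp
  then show ?case using \<open>?g \<circ> f permutes set (concat (xs # Ws))\<close> by blast
qed

lemma cyc_nth: "cyc f xs \<Longrightarrow> i < length xs \<Longrightarrow> xs ! i = (f ^^ i) (hd xs)"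
proof (induction i)
  case 0
  then show ?case by (simp add: hd_conv_nth)
next
  case (Suc i)
  have "cconsec xs (xs ! i) (xs ! Suc i)" using consec_nth[OF Suc.prems(2)] by (simp add: cconsec_def)
  then have "f (xs ! i) = xs ! Suc i" using Suc.prems(1) by (simp add: cyc_def)
  then show ?case using Suc by simp
qed

lemma cyc_unique:
  assumes "cyc f xs" "cyc f ys" "hd xs = hd ys"
  shows "xs = ys"
proof -
  have "set xs = orbit f (hd xs)" "set ys = orbit f (hd ys)"
    using orbit_cyc[OF assms(1)] orbit_cyc[OF assms(2)] assms(1,2) by (auto simp: cyc_def)
  then have "set xs = set ys" using assms(3) by simp
  moreover have "distinct xs" "distinct ys" using assms by (auto simp: cyc_def)
  ultimately have "length xs = length ys" using distinct_card by metis
  then show ?thesis using cyc_nth[OF assms(1)] cyc_nth[OF assms(2)] assms(3) by (auto intro: nth_equalityI)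
qed

text \<open>The maps have to be intertwined only on the invariant set A. Face tracing will be
  compared with \<open>nxt\<close>, and with the inverse of \<open>nxt \<circ> t\<close>, on E
  alone.\<close>

lemma orbit_conj:
  assumes "\<And>y. y \<in> A \<Longrightarrow> g y \<in> A \<and> f (r y) = r (g y)" "x \<in> A"
  shows "orbit f (r x) = r ` orbit g x"
proof
  have "z \<in> r ` (orbit g x \<inter> A)" if "z \<in> orbit f (r x)" for z
    using that
  proof induction
    case base
    then show ?case using assms orbit.base[of g x] by auto
  next
    case (step z)
    then obtain y where "y \<in> orbit g x" "y \<in> A" "z = r y" by blast
    then show ?case using assms(1) orbit.step[of y g x] by auto
  qed
  then show "orbit f (r x) \<subseteq> r ` orbit g x" by blast
  have "z \<in> A \<and> r z \<in> orbit f (r x)" if "z \<in> orbit g x" for z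
    using that
  proof induction
    case base
    then show ?case using assms orbit.base[of f "r x"] by auto
  next
    case (step z)
    then show ?case using assms(1) orbit.step[of "r z" f "r x"] by auto
  qed
  then show "r ` orbit g x \<subseteq> orbit f (r x)" by blast
qed

lemma cycle3_permutes:
  assumes "a \<in> A" "b \<in> A" "c \<in> A" "a \<noteq> b" "a \<noteq> c" "b \<noteq> c"
  shows "cycle3 a b c permutes A"
proof -
  have "cycle3 a b c = transpose a b \<circ> transpose b c"
    using assms by (auto simp: cycle3_def transpose_def fun_eq_iff)
  then show ?thesis using assms by (simp add: permutes_compose permutes_swap_id)
qed

lemma cycle3_rotate: "a \<noteq> b \<Longrightarrow> a \<noteq> c \<Longrightarrow> b \<noteq> c \<Longrightarrow> cycle3 b a c = cycle3 a c b"
  by (auto simp: cycle3_def fun_eq_iff)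

text \<open>The cyclic order of a, b, c along ts decides: one of the two products reorders the three
  segments ending there and stays one cycle. This is why the axioms of the word system offer
  alternatives.\<close>

lemma cyc_cycle3:
  assumes "cyc f ts" "a \<in> set ts" "b \<in> set ts" "c \<in> set ts" "a \<noteq> b" "a \<noteq> c" "b \<noteq> c"
  shows "(\<exists>us. cyc (f \<circ> cycle3 a b c) us \<and> set us = set ts) \<or>
    (\<exists>us. cyc (f \<circ> cycle3 a c b) us \<and> set us = set ts)"
proof -
  obtain A B where AB: "ts = A @ c # B" using assms(4) by (auto dest: split_list)
  let ?T = "B @ A"
  have T: "cyc f (?T @ [c])" using cyc_rotate[of f "A @ [c]" B] assms(1) AB by simp
  have setT: "set (?T @ [c]) = set ts" using AB by auto
  then have ab: "a \<in> set ?T" "b \<in> set ?T" using assms AB by auto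
  obtain P Q where PQ: "?T = P @ a # Q" using ab(1) by (metis split_list)
  consider (1) P' Q' where "Q = P' @ b # Q'" | (2) P' Q' where "P = P' @ b # Q'"
    using ab(2) assms(5) unfolding PQ by (auto dest: split_list)
  then show ?thesis
  proof cases
    case 1
    let ?X = "P @ [a]" and ?Y = "P' @ [b]" and ?Z = "Q' @ [c]"
    have c: "cyc f (?X @ ?Y @ ?Z)" using T PQ 1 by simp
    then have d: "distinct (?X @ ?Y @ ?Z)" by (simp add: cyc_def)
    have "cyc (f \<circ> cycle3 a b c) (?X @ ?Z @ ?Y)"
      by (rule cyc_split(1)[OF _ _ _ _ _ _ d c]) simp_all
    moreover have "set (?X @ ?Z @ ?Y) = set ts" unfolding setT[symmetric] PQ 1 by auto
    ultimately show ?thesis by blast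
  next
    case 2
    let ?X = "P' @ [b]" and ?Y = "Q' @ [a]" and ?Z = "Q @ [c]"
    have c: "cyc f (?X @ ?Y @ ?Z)" using T PQ 2 by simp
    then have d: "distinct (?X @ ?Y @ ?Z)" by (simp add: cyc_def)
    have "cyc (f \<circ> cycle3 b a c) (?X @ ?Z @ ?Y)"
      by (rule cyc_split(1)[OF _ _ _ _ _ _ d c]) simp_all
    moreover have "set (?X @ ?Z @ ?Y) = set ts" unfolding setT[symmetric] PQ 2 by auto
    ultimately show ?thesis using cycle3_rotate assms(5-7) by metis
  qed
qed

section \<open>Cyclic shifts and classes of closed walks\<close>

definition rotations :: "'a list \<Rightarrow> 'a list set" where
  "rotations w = {ys @ xs | xs ys. w = xs @ ys}"

lemma rotations_range: "rotations w = range (\<lambda>i. rotate i w)"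
proof
  show "rotations w \<subseteq> range (\<lambda>i. rotate i w)"
  proof
    fix v assume "v \<in> rotations w"
    then obtain xs ys where "w = xs @ ys" "v = ys @ xs" by (auto simp: rotations_def)
    then have "v = rotate (length xs) w" by (simp add: rotate_append)
    then show "v \<in> range (\<lambda>i. rotate i w)" by blast
  qed
  show "range (\<lambda>i. rotate i w) \<subseteq> rotations w"
    unfolding rotations_def by (auto simp: rotate_drop_take) (metis append_take_drop_id)
qed

lemma rotations_sym: "v \<in> rotations w \<Longrightarrow> w \<in> rotations v"
  unfolding rotations_def by blast

lemma rotations_eq: "v \<in> rotations w \<Longrightarrow> rotations v = rotations w"
proof -
  have "rotations v \<subseteq> rotations w" if "v \<in> rotations w" for v w :: "'a list"
    using that unfolding rotations_range by (auto simp: rotate_rotate)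
  then show "v \<in> rotations w \<Longrightarrow> rotations v = rotations w" using rotations_sym by blast
qed

lemma walk_class_rotations: "walk_class rv w = rotations w \<union> rotations (reverse_walk rv w)"
  unfolding walk_class_def rotations_range by blast

lemma walk_class_rotate:
  assumes "v \<in> rotations w"
  shows "walk_class rv v = walk_class rv w"
proof -
  obtain xs ys where "w = xs @ ys" "v = ys @ xs" using assms by (auto simp: rotations_def)
  then have "reverse_walk rv v \<in> rotations (reverse_walk rv w)"
    unfolding reverse_walk_def rotations_def by auto
  then show ?thesis using rotations_eq assms unfolding walk_class_rotations by metis
qed

lemma walk_class_length: "x \<in> walk_class rv w \<Longrightarrow> length x = length w"
  unfolding walk_class_def reverse_walk_def by auto

lemma walk_class_self: "w \<in> walk_class rv w"
  unfolding walk_class_def by (auto intro!: exI[of _ 0])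

lemma walk_class_reverse: "reverse_walk rv w \<in> walk_class rv w"
  unfolding walk_class_def by (auto intro!: exI[of _ 0])

lemma walk_class_set: "x \<in> walk_class rv w \<Longrightarrow> set x = set w \<or> set x = rv ` set w"
  unfolding walk_class_def reverse_walk_def by auto

section \<open>Circuit decompositions and rotation systems\<close>

text \<open>Without isolated vertices each vertex gives exactly one cycle of a rotation, on which
  the parity counts rely.\<close>

locale circuit_graph =
  fixes G :: "('v, 'e) pre_digraph" and rv :: "'e \<Rightarrow> 'e" and C :: "'e list set set"
  assumes mg: "multigraph G rv" and cd: "circuit_decomposition G rv C"
    and no_isolated: "v \<in> verts G \<Longrightarrow> out_arcs G v \<noteq> {}"
begin

sublocale fin_digraph G using mg by (simp add: multigraph_def)
sublocale bidirected_digraph G rv using mg by (simp add: multigraph_def)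

definition rep :: "'e list set \<Rightarrow> 'e list" where
  "rep c = (SOME w. circuit_walk G rv w \<and> c = walk_class rv w)"

lemma rep: "c \<in> C \<Longrightarrow> circuit_walk G rv (rep c)" "c \<in> C \<Longrightarrow> walk_class rv (rep c) = c"
proof -
  assume "c \<in> C"
  then have "\<exists>w. circuit_walk G rv w \<and> c = walk_class rv w"
    using cd by (auto simp: circuit_decomposition_def circuits_def)
  from someI_ex[OF this] show "circuit_walk G rv (rep c)" "walk_class rv (rep c) = c"
    by (simp_all add: rep_def)
qed

text \<open>Choosing representatives orients the circuits, and E collects the arcs so traversed. It
  contains one arc of every edge and therefore also stands for the edge set.\<close>

definition E :: "'e set" where "E = (\<Union>c \<in> C. set (rep c))"

lemma rep_arcs: "c \<in> C \<Longrightarrow> set (rep c) \<subseteq> arcs G"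
  using rep(1) by (auto simp: circuit_walk_def awalk_def)

lemma rep_nonempty: "c \<in> C \<Longrightarrow> rep c \<noteq> []" and rep_distinct: "c \<in> C \<Longrightarrow> distinct (rep c)"
  and rep_rv: "c \<in> C \<Longrightarrow> a \<in> set (rep c) \<Longrightarrow> rv a \<notin> set (rep c)"
  using rep(1) by (auto simp: circuit_walk_def)

lemma on_circuit:
  assumes "c \<in> C"
  shows "(\<exists>w \<in> c. a \<in> set w) \<longleftrightarrow> a \<in> set (rep c) \<or> rv a \<in> set (rep c)"
proof
  assume "\<exists>w \<in> c. a \<in> set w"
  then obtain w where w: "w \<in> walk_class rv (rep c)" "a \<in> set w" using rep(2)[OF assms] by auto
  from walk_class_set[OF w(1)] w(2) show "a \<in> set (rep c) \<or> rv a \<in> set (rep c)" by auto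
next
  assume a: "a \<in> set (rep c) \<or> rv a \<in> set (rep c)"
  have "set (reverse_walk rv (rep c)) = rv ` set (rep c)" by (simp add: reverse_walk_def)
  then have "a \<in> set (rep c) \<or> a \<in> set (reverse_walk rv (rep c))"
    using a arev_arev by (metis image_eqI)
  then show "\<exists>w \<in> c. a \<in> set w"
    using walk_class_self walk_class_reverse rep(2)[OF assms] by metis
qed

lemma unique_circuit:
  assumes "a \<in> arcs G"
  shows "\<exists>!c. c \<in> C \<and> (a \<in> set (rep c) \<or> rv a \<in> set (rep c))"
proof -
  have "\<exists>!c. c \<in> C \<and> (\<exists>w \<in> c. a \<in> set w)" using cd assms by (auto simp: circuit_decomposition_def)
  then show ?thesis using on_circuit by metis
qed

lemma rep_disjoint:
  assumes "c \<in> C" "d \<in> C" "a \<in> set (rep c)" "a \<in> set (rep d) \<or> rv a \<in> set (rep d)"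
  shows "c = d"
  using unique_circuit[of a] assms rep_arcs by blast

lemma E_arcs: "E \<subseteq> arcs G"
  using rep_arcs by (auto simp: E_def)

lemma rv_not_E: "a \<in> E \<Longrightarrow> rv a \<notin> E"
  unfolding E_def using rep_disjoint rep_rv by blast

lemma arcs_cases: "a \<in> arcs G \<Longrightarrow> a \<in> E \<or> rv a \<in> E"
  using unique_circuit[of a] unfolding E_def by blast

lemma arcs_eq: "arcs G = E \<union> rv ` E" "E \<inter> rv ` E = {}"
  using arcs_cases E_arcs rv_not_E arev_in_arcs by (auto, metis arev_arev image_eqI)

lemma finite_E: "finite E"
  using E_arcs finite_arcs finite_subset by blast

lemma card_arcs: "card (arcs G) = 2 * card E"
proof -
  have "card (arcs G) = card E + card (rv ` E)"
    using arcs_eq finite_E by (simp add: card_Un_disjoint)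
  then show ?thesis by (simp add: card_image inj_on_arev)
qed

lemma edges_eq: "edges G rv = (\<lambda>a. {a, rv a}) ` E"
  unfolding edges_def arcs_eq(1) by (auto simp: image_Un insert_commute)

lemma card_edges: "card (edges G rv) = card E"
proof -
  have "inj_on (\<lambda>a. {a, rv a}) E"
  proof (rule inj_onI)
    fix a b assume ab: "a \<in> E" "b \<in> E" "{a, rv a} = {b, rv b}"
    then have "a = b \<or> a = rv b" by blast
    then show "a = b" using ab rv_not_E by auto
  qed
  then show ?thesis unfolding edges_eq by (rule card_image)
qed

lemma rep_hd: "c \<in> C \<Longrightarrow> hd (rep c) \<in> set (rep c)"
  using rep_nonempty by simp

lemma inj_rep: "inj_on (\<lambda>c. set (rep c)) C"
  by (rule inj_onI) (metis rep_hd rep_disjoint)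

lemma finite_C: "finite C"
proof -
  have "(\<lambda>c. set (rep c)) ` C \<subseteq> Pow E" by (auto simp: E_def)
  then show ?thesis using finite_E inj_rep by (meson finite_Pow_iff finite_subset inj_on_finite)
qed

definition inE :: "'v \<Rightarrow> 'e set" where "inE v = {e \<in> E. head G e = v}"

lemma exists_next: "\<exists>p. p permutes E \<and> (\<forall>c \<in> C. cyc p (rep c))"
proof -
  obtain cs where cs: "set cs = C" "distinct cs" using finite_distinct_list[OF finite_C] by metis
  have "distinct (concat (map rep cs))"
  proof (rule distinct_concat)
    have "inj_on rep C"
    proof (rule inj_onI)
      fix c d assume "c \<in> C" "d \<in> C" "rep c = rep d"
      then show "c = d" using rep(2) by metis
    qed
    then show "distinct (map rep cs)" using cs by (simp add: distinct_map)
    show "distinct ys" if "ys \<in> set (map rep cs)" for ys using that rep_distinct cs(1) by auto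
    show "set ys \<inter> set zs = {}" if yz: "ys \<in> set (map rep cs)" "zs \<in> set (map rep cs)" "ys \<noteq> zs" for ys zs
    proof -
      obtain c d where "c \<in> C" "d \<in> C" "ys = rep c" "zs = rep d" using yz(1,2) cs(1) by auto
      then show ?thesis using yz(3) rep_disjoint by blast
    qed
  qed
  moreover have "[] \<notin> set (map rep cs)" using rep_nonempty cs(1) by (metis imageE set_map)
  moreover have "set (concat (map rep cs)) = E" using cs(1) by (simp add: E_def)
  ultimately obtain p where "p permutes E" "decomp p E (map rep cs)"
    using permutation_from_cycles[of "map rep cs"] by metis
  then show ?thesis using cs(1) by (auto simp: decomp_def)
qed

definition nxt :: "'e \<Rightarrow> 'e" where
  "nxt = (SOME p. p permutes E \<and> (\<forall>c \<in> C. cyc p (rep c)))"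

lemma nxt: "nxt permutes E" "c \<in> C \<Longrightarrow> cyc nxt (rep c)"
  using someI_ex[OF exists_next] by (auto simp: nxt_def)

lemma orbit_nxt: "c \<in> C \<Longrightarrow> a \<in> set (rep c) \<Longrightarrow> orbit nxt a = set (rep c)"
  using orbit_cyc nxt(2) by metis

lemma orbits_nxt: "orbit nxt ` E = (\<lambda>c. set (rep c)) ` C"
proof
  show "orbit nxt ` E \<subseteq> (\<lambda>c. set (rep c)) ` C" using orbit_nxt by (auto simp: E_def)
  show "(\<lambda>c. set (rep c)) ` C \<subseteq> orbit nxt ` E"
  proof
    fix A assume "A \<in> (\<lambda>c. set (rep c)) ` C"
    then obtain c where c: "c \<in> C" "A = set (rep c)" by blast
    then have "hd (rep c) \<in> set (rep c)" using rep_hd by simp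
    then have "A = orbit nxt (hd (rep c))" "hd (rep c) \<in> E" using c orbit_nxt by (auto simp: E_def)
    then show "A \<in> orbit nxt ` E" by blast
  qed
qed

lemma tail_nxt:
  assumes "e \<in> E"
  shows "tail G (nxt e) = head G e"
proof -
  obtain c where c: "c \<in> C" "e \<in> set (rep c)" using assms by (auto simp: E_def)
  obtain u where u: "awalk u (rep c) u" using rep(1)[OF c(1)] by (auto simp: circuit_walk_def)
  obtain A B where AB: "rep c = A @ e # B" using c(2) by (auto dest: split_list)
  show ?thesis
  proof (cases B)
    case Nil
    have "cconsec (rep c) e (hd (rep c))" using AB Nil by (simp add: cconsec_def)
    then have "nxt e = hd (rep c)" using nxt(2)[OF c(1)] by (simp add: cyc_def)
    moreover have "head G e = u" using u AB Nil by (simp add: awalk_def)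
    moreover have "tail G (hd (rep c)) = u" using u AB by (cases A) (auto simp: awalk_def)
    ultimately show ?thesis by simp
  next
    case (Cons b B')
    have "cconsec (rep c) e b" using AB Cons by (auto simp: cconsec_def consec_def)
    then have "nxt e = b" using nxt(2)[OF c(1)] by (simp add: cyc_def)
    moreover have "tail G b = head G e" using u AB Cons by (simp add: awalk_def)
    ultimately show ?thesis by simp
  qed
qed

lemma nxt_E: "nxt e \<in> E \<longleftrightarrow> e \<in> E"
  using permutes_in_image[OF nxt(1)] .

lemma prev_E: "e \<in> E \<Longrightarrow> \<exists>e' \<in> E. nxt e' = e"
  using permutes_image[OF nxt(1)] by (metis imageE)

text \<open>An arc leaving v either lies in E, and then its predecessor on the circuit enters v, or
  its reverse lies in E and enters v.\<close>

lemma inE_nonempty: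
  assumes "v \<in> verts G"
  shows "inE v \<noteq> {}"
proof -
  obtain a where a: "a \<in> arcs G" "tail G a = v" 
    using no_isolated[OF assms] by (metis ex_in_conv in_out_arcs_conv)
  from arcs_cases[OF a(1)] show ?thesis
  proof
    assume "a \<in> E"
    then obtain e where "e \<in> E" "nxt e = a" using prev_E by blast
    then have "e \<in> inE v" using tail_nxt a by (auto simp: inE_def)
    then show ?thesis by blast
  next
    assume "rv a \<in> E"
    then have "rv a \<in> inE v" using a by (simp add: inE_def)
    then show ?thesis by blast
  qed
qed

text \<open>This is the free data of an embedding that has the oriented circuits as faces: a cyclic
  order of the circuit arcs entering each vertex.\<close>

definition rotation :: "('e \<Rightarrow> 'e) \<Rightarrow> bool" where
  "rotation t \<longleftrightarrow> t permutes E \<and> (\<forall>v \<in> verts G. \<exists>ts. cyc t ts \<and> set ts = inE v)"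

lemma head_E: "e \<in> E \<Longrightarrow> head G e \<in> verts G"
  by (rule head_in_verts[OF subsetD[OF E_arcs]])

lemma exists_rotation: "\<exists>t. rotation t"
proof -
  obtain vs where vs: "set vs = verts G" "distinct vs" using finite_distinct_list[OF finite_verts] by metis
  have "\<exists>ts. set ts = inE v \<and> distinct ts" for v
    using finite_distinct_list[of "inE v"] finite_E by (simp add: inE_def)
  then obtain L where L: "\<And>v. set (L v) = inE v" "\<And>v. distinct (L v)" by metis
  have ne: "L v \<noteq> []" if "v \<in> verts G" for v using inE_nonempty[OF that] L(1)[of v] by auto
  have "distinct (concat (map L vs))"
  proof (rule distinct_concat)
    have "inj_on L (verts G)"
    proof (rule inj_onI)
      fix u v assume uv: "u \<in> verts G" "v \<in> verts G" "L u = L v"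
      then have "hd (L u) \<in> inE u \<inter> inE v" using ne L(1) by (metis IntI hd_in_set)
      then show "u = v" by (auto simp: inE_def)
    qed
    then show "distinct (map L vs)" using vs by (simp add: distinct_map)
    show "distinct ys" if "ys \<in> set (map L vs)" for ys using that L(2) by auto
    show "set ys \<inter> set zs = {}" if yz: "ys \<in> set (map L vs)" "zs \<in> set (map L vs)" "ys \<noteq> zs" for ys zs
    proof -
      obtain u v where uv: "ys = L u" "zs = L v" using yz(1,2) by auto
      then have "u \<noteq> v" using yz(3) by blast
      then show ?thesis unfolding uv L(1) by (auto simp: inE_def)
    qed
  qed
  moreover have "[] \<notin> set (map L vs)" using ne vs(1) by (metis imageE set_map)
  moreover have "set (concat (map L vs)) = E" using vs(1) L(1) head_E by (auto simp: inE_def)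
  ultimately obtain t where "t permutes E" "decomp t E (map L vs)"
    using permutation_from_cycles[of "map L vs"] by metis
  then have "rotation t" using vs(1) L(1) unfolding rotation_def decomp_def by auto
  then show ?thesis by blast
qed

text \<open>At the common head \<open>cyc_cycle3\<close> keeps one of the products cyclic; at the
  other vertices both leave the order unchanged.\<close>

lemma rotation_cycle3:
  assumes t: "rotation t" and E: "a \<in> E" "b \<in> E" "c \<in> E" and ne: "a \<noteq> b" "a \<noteq> c" "b \<noteq> c"
    and h: "head G a = head G b" "head G b = head G c"
  shows "rotation (t \<circ> cycle3 a b c) \<or> rotation (t \<circ> cycle3 a c b)"
proof -
  obtain ts where ts: "cyc t ts" "set ts = inE (head G a)" using t head_E[OF E(1)] by (auto simp: rotation_def)
  have abc: "a \<in> set ts" "b \<in> set ts" "c \<in> set ts" using E h ts(2) by (auto simp: inE_def)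
  have p: "t \<circ> cycle3 a b c permutes E" "t \<circ> cycle3 a c b permutes E"
    using t cycle3_permutes E ne unfolding rotation_def by (metis permutes_compose)+
  have other: "(\<exists>us. cyc (t \<circ> cycle3 a b c) us \<and> set us = inE v) \<and>
      (\<exists>us. cyc (t \<circ> cycle3 a c b) us \<and> set us = inE v)"
    if v: "v \<in> verts G" "v \<noteq> head G a" for v
  proof -
    obtain us where us: "cyc t us" "set us = inE v" using t v(1) by (auto simp: rotation_def)
    then have "a \<notin> set us" "b \<notin> set us" "c \<notin> set us" using v(2) h by (auto simp: inE_def)
    then show ?thesis using us cyc_cycle3_other[OF us(1)] by blast
  qed
  from cyc_cycle3[OF ts(1) abc ne] show ?thesis
  proof
    assume "\<exists>us. cyc (t \<circ> cycle3 a b c) us \<and> set us = set ts"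
    then have "rotation (t \<circ> cycle3 a b c)" unfolding rotation_def using p(1) other ts(2) by metis
    then show ?thesis by blast
  next
    assume "\<exists>us. cyc (t \<circ> cycle3 a c b) us \<and> set us = set ts"
    then have "rotation (t \<circ> cycle3 a c b)" unfolding rotation_def using p(2) other ts(2) by metis
    then show ?thesis by blast
  qed
qed

lemma few_other_faces:
  assumes adj: "\<And>x y. adj x y \<longleftrightarrow> x \<noteq> y \<and> (x, y) \<in> arcs_ends G"
    and dense: "\<And>x. x \<in> verts G \<Longrightarrow> card {y \<in> verts G. y \<noteq> x \<and> \<not> adj x y} \<le> N"
    and large: "5 * N + 7 \<le> card (verts G)"
  shows "\<exists>t. rotation t \<and> card (orbit (nxt \<circ> t) ` E) \<le> 2"
proof -
  let ?S = "{nxt \<circ> t | t. rotation t}"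
  interpret face_perms E ?S "head G" "verts G" adj N
  proof
    show "?S \<noteq> {}" using exists_rotation by blast
    show "finite E" by (rule finite_E)
    show "head G ` E \<subseteq> verts G" using head_E by blast
    show "f permutes E" if "f \<in> ?S" for f
      using that nxt(1) permutes_compose unfolding rotation_def by blast
    show "f \<circ> cycle3 a b c \<in> ?S \<or> f \<circ> cycle3 a c b \<in> ?S"
      if a: "f \<in> ?S" "a \<in> E" "b \<in> E" "c \<in> E" "a \<noteq> b" "a \<noteq> c" "b \<noteq> c"
        "head G a = head G b" "head G b = head G c" for f a b c
    proof -
      obtain t where t: "f = nxt \<circ> t" "rotation t" using a(1) by blast
      have "f \<circ> cycle3 a b c = nxt \<circ> (t \<circ> cycle3 a b c)" "f \<circ> cycle3 a c b = nxt \<circ> (t \<circ> cycle3 a c b)"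
        unfolding t(1) by (simp_all add: comp_assoc)
      then show ?thesis using rotation_cycle3[OF t(2) a(2-9)] by blast
    qed
    show "\<exists>e \<in> E. (head G e = x \<and> head G (f e) = y) \<or> (head G e = y \<and> head G (f e) = x)"
      if a: "f \<in> ?S" "adj x y" for f x y
    proof -
      obtain t where t: "f = nxt \<circ> t" "rotation t" using a(1) by blast
      have f: "f permutes E" using t nxt(1) permutes_compose unfolding rotation_def by blast
      have "(x, y) \<in> arcs_ends G" using a(2) unfolding adj by simp
      then obtain a where "a \<in> arcs G" "tail G a = x" "head G a = y"
        by (auto simp: arcs_ends_def arc_to_ends_def)
      then obtain e where e: "e \<in> E" "(tail G e = x \<and> head G e = y) \<or> (tail G e = y \<and> head G e = x)"
        using arcs_cases[of a] by force
      \<comment> \<open>The map f first applies t, which keeps the head, and then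
        \<open>nxt\<close>, which continues from that head; hence the predecessor of e ends at the
        tail of e.\<close>
      obtain e0 where e0: "e0 \<in> E" "f e0 = e" using permutes_image[OF f] e(1) by (metis imageE)
      obtain ts where ts: "cyc t ts" "set ts = inE (head G e0)"
        using t(2) head_E[OF e0(1)] by (auto simp: rotation_def)
      have "e0 \<in> set ts" using ts(2) e0(1) by (simp add: inE_def)
      then have "t e0 \<in> set ts" using orbit_cyc[OF ts(1)] orbit.base[of t e0] by simp
      then have "t e0 \<in> E" "head G (t e0) = head G e0" using ts(2) by (auto simp: inE_def)
      then have "tail G e = head G e0" using tail_nxt e0(2) t(1) by auto
      then show ?thesis using e e0 by auto
    qed
    show "adj y x" if "adj x y" for x y
    proof -
      have "(x, y) \<in> arcs_ends G" "x \<noteq> y" using that unfolding adj by simp_all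
      then obtain a where "a \<in> arcs G" "tail G a = x" "head G a = y" "x \<noteq> y"
        by (auto simp: arcs_ends_def arc_to_ends_def)
      then have "rv a \<in> arcs G" "tail G (rv a) = y" "head G (rv a) = x" by auto
      then show ?thesis using adj \<open>x \<noteq> y\<close> by (auto simp: arcs_ends_def arc_to_ends_def rev_image_eqI)
    qed
    show "finite (verts G)" by simp
  qed (use dense large in auto)
  obtain Ks where Ks: "Ks \<in> D" "length Ks \<le> 2" using at_most_two_words by blast
  then obtain t Ls where "rotation t" "decomp (nxt \<circ> t) E Ls" "Ks = map (map (head G)) Ls"
    unfolding D_def by blast
  then show ?thesis using decomp_orbits(2) Ks(2) by (metis length_map)
qed

end

section \<open>Faces and genus\<close>

context circuit_graph
begin

text \<open>The rotation at a vertex alternates between arriving arcs of \<open>E\<close> (reversed) and departing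
  ones, so that the faces on the \<open>E\<close> side are the circuits.\<close>

definition rot_of :: "('e \<Rightarrow> 'e) \<Rightarrow> 'e \<Rightarrow> 'e" where
  "rot_of t a = (if a \<in> E then rv (inv (nxt \<circ> t) a) else if a \<in> arcs G then nxt (rv a) else a)"

context
  fixes t :: "'e \<Rightarrow> 'e"
  assumes t: "rotation t"
begin

lemma t_permutes: "t permutes E" and f_permutes: "nxt \<circ> t permutes E"
  using t nxt(1) permutes_compose unfolding rotation_def by blast+

lemma inv_f: "inv (nxt \<circ> t) permutes E" "inv (nxt \<circ> t) (nxt e) = inv t e"
proof -
  show "inv (nxt \<circ> t) permutes E" by (rule permutes_inv[OF f_permutes])
  have "inv (nxt \<circ> t) = inv t \<circ> inv nxt"
    using o_inv_distrib permutes_bij[OF nxt(1)] permutes_bij[OF t_permutes] by blast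
  then show "inv (nxt \<circ> t) (nxt e) = inv t e" using permutes_inverses(2)[OF nxt(1)] by simp
qed

text \<open>On E face tracing follows the circuits; on reversed arcs it runs through the cycles of
  \<open>nxt \<circ> t\<close> backwards. This is how the remaining faces are counted.\<close>

lemma rot_of_simps:
  "a \<in> E \<Longrightarrow> rot_of t a = rv (inv (nxt \<circ> t) a)"
  "a \<in> E \<Longrightarrow> rot_of t (rv a) = nxt a"
  "a \<in> E \<Longrightarrow> face_succ rv (rot_of t) a = nxt a"
  "a \<in> E \<Longrightarrow> face_succ rv (rot_of t) (rv a) = rv (inv (nxt \<circ> t) a)"
  using rv_not_E E_arcs by (auto simp: rot_of_def face_succ_def)

lemma rot_of_permutes: "rot_of t permutes arcs G"
proof (rule bij_imp_permutes)
  have rv1: "bij_betw rv E (rv ` E)" and rv2: "bij_betw rv (rv ` E) E"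
    by (auto intro!: bij_betwI[of _ _ _ rv])
  have "bij_betw (rv \<circ> inv (nxt \<circ> t)) E (rv ` E)"
    by (rule bij_betw_trans[OF permutes_imp_bij[OF inv_f(1)] rv1])
  then have 1: "bij_betw (rot_of t) E (rv ` E)" by (rule bij_betw_cong[THEN iffD2, rotated]) (simp add: rot_of_simps)
  have "bij_betw (nxt \<circ> rv) (rv ` E) E"
    by (rule bij_betw_trans[OF rv2 permutes_imp_bij[OF nxt(1)]])
  then have 2: "bij_betw (rot_of t) (rv ` E) E"
    by (rule bij_betw_cong[THEN iffD2, rotated]) (auto simp: rot_of_simps)
  show "bij_betw (rot_of t) (arcs G) (arcs G)"
    using bij_betw_combine[OF 1 2] arcs_eq by (simp add: Un_commute Int_commute)
  show "rot_of t a = a" if "a \<notin> arcs G" for a using that E_arcs by (auto simp: rot_of_def)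
qed

lemma out_arcs_eq: "out_arcs G v = rv ` inE v \<union> nxt ` inE v"
proof
  show "out_arcs G v \<subseteq> rv ` inE v \<union> nxt ` inE v"
  proof
    fix a assume "a \<in> out_arcs G v"
    then have a: "a \<in> arcs G" "tail G a = v" by auto
    from arcs_cases[OF a(1)] show "a \<in> rv ` inE v \<union> nxt ` inE v"
    proof
      assume "a \<in> E"
      then obtain e where "e \<in> E" "nxt e = a" using prev_E by blast
      then show ?thesis using tail_nxt a(2) by (auto simp: inE_def)
    next
      assume "rv a \<in> E"
      then have "rv a \<in> inE v" using a by (simp add: inE_def)
      then show ?thesis using arev_arev by (metis UnI1 image_eqI)
    qed
  qed
  show "rv ` inE v \<union> nxt ` inE v \<subseteq> out_arcs G v"
  proof -
    have "nxt e \<in> arcs G" "e \<in> arcs G" if "e \<in> E" for e using nxt_E E_arcs that by blast+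
    then show ?thesis using tail_nxt by (auto simp: inE_def)
  qed
qed

lemma inv_t_inE:
  assumes "v \<in> verts G" "e \<in> inE v"
  shows "orbit (inv t) e = inE v"
proof -
  obtain ts where ts: "cyc t ts" "set ts = inE v" using t assms(1) by (auto simp: rotation_def)
  have "permutation t" using t_permutes finite_E by (auto simp: permutation_permutes)
  then show ?thesis using orbit_inv_eq orbit_cyc[OF ts(1)] ts(2) assms(2) by metis
qed

text \<open>Two steps of \<open>rot_of t\<close> lead from \<open>rv x\<close> via
  \<open>nxt x\<close> to \<open>rv (inv t x)\<close>. Since \<open>inv t\<close> runs through all
  of \<open>inE v\<close>, every arc leaving v is reached.\<close>

lemma rot_of_cyclic:
  assumes v: "v \<in> verts G"
  shows "cyclic_on (rot_of t) (out_arcs G v)"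
proof -
  obtain e where e: "e \<in> inE v" using inE_nonempty[OF v] by blast
  let ?s = "rot_of t"
  have inE_E: "x \<in> inE v \<Longrightarrow> x \<in> E" for x by (simp add: inE_def)
  have step: "?s (nxt x) = rv (inv t x)" "?s (rv x) = nxt x" if "x \<in> inE v" for x
    using rot_of_simps(1)[of "nxt x"] rot_of_simps(2)[of x] inE_E[OF that] nxt_E inv_f(2) by auto
  have inv: "inv t x \<in> inE v" if "x \<in> inE v" for x
    using inv_t_inE[OF v that] orbit.base[of "inv t" x] by simp
  have reach: "rv x \<in> orbit ?s (rv e) \<and> nxt x \<in> orbit ?s (rv e)" if "x \<in> orbit (inv t) e" for x
    using that
  proof induction
    case base
    have "nxt e \<in> orbit ?s (rv e)" using orbit.base[of ?s "rv e"] step(2)[OF e] by simp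
    then have "rv (inv t e) \<in> orbit ?s (rv e)" using orbit.step[of "nxt e" ?s] step(1)[OF e] by metis
    then show ?case using orbit.step[of "rv (inv t e)" ?s] step(2)[OF inv[OF e]] by metis
  next
    case (step x)
    then have x: "x \<in> inE v" using inv_t_inE[OF v e] by simp
    have "rv (inv t x) \<in> orbit ?s (rv e)"
      using step.IH orbit.step[of "nxt x" ?s] \<open>x \<in> inE v \<Longrightarrow> ?s (nxt x) = rv (inv t x)\<close>[OF x] by metis
    then show ?case
      using orbit.step[of "rv (inv t x)" ?s] \<open>\<And>x. x \<in> inE v \<Longrightarrow> ?s (rv x) = nxt x\<close>[OF inv[OF x]] by metis
  qed
  then have "out_arcs G v \<subseteq> orbit ?s (rv e)"
    unfolding out_arcs_eq using inv_t_inE[OF v e] by blast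
  moreover have "x \<in> out_arcs G v" if "x \<in> orbit ?s (rv e)" for x
    using that
  proof induction
    case base
    show ?case unfolding out_arcs_eq using step(2)[OF e] e by simp
  next
    case (step x)
    then show ?case unfolding out_arcs_eq using \<open>\<And>x. x \<in> inE v \<Longrightarrow> ?s (rv x) = nxt x\<close>
      \<open>\<And>x. x \<in> inE v \<Longrightarrow> ?s (nxt x) = rv (inv t x)\<close> inv by auto
  qed
  moreover have "rv e \<in> out_arcs G v" unfolding out_arcs_eq using e by blast
  ultimately show ?thesis unfolding cyclic_on_def by blast
qed

lemma rot_of_embedding: "orientable_embedding G (rot_of t)"
  unfolding orientable_embedding_def using rot_of_permutes rot_of_cyclic by blast

lemma face_of_E:
  assumes "c \<in> C" "a \<in> set (rep c)"
  shows "face_of rv (rot_of t) a = set (rep c)"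
proof -
  have "a \<in> E" using assms by (auto simp: E_def)
  then have "orbit (face_succ rv (rot_of t)) (id a) = id ` orbit nxt a"
    by (intro orbit_conj[of E]) (simp_all add: nxt_E rot_of_simps)
  then show ?thesis using orbit_nxt[OF assms] by (simp add: face_of_def)
qed

lemma face_of_rv:
  assumes "a \<in> E"
  shows "face_of rv (rot_of t) (rv a) = rv ` orbit (nxt \<circ> t) a"
proof -
  have "orbit (face_succ rv (rot_of t)) (rv a) = rv ` orbit (inv (nxt \<circ> t)) a"
    using assms permutes_in_image[OF inv_f(1)] by (intro orbit_conj[of E]) (simp_all add: rot_of_simps)
  moreover have "permutation (nxt \<circ> t)" using f_permutes finite_E by (auto simp: permutation_permutes)
  ultimately show ?thesis by (simp add: face_of_def orbit_inv_eq)
qed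

definition circuit_faces :: "'e set set" where
  "circuit_faces = (\<lambda>c. set (rep c)) ` C"

lemma faces_rot_of: "faces G rv (rot_of t) = circuit_faces \<union> (\<lambda>A. rv ` A) ` (orbit (nxt \<circ> t) ` E)"
proof -
  have "face_of rv (rot_of t) ` E = circuit_faces"
  proof -
    have "face_of rv (rot_of t) a = orbit nxt a" if "a \<in> E" for a
      using that face_of_E orbit_nxt unfolding E_def by blast
    then have "face_of rv (rot_of t) ` E = orbit nxt ` E" by (rule image_cong[OF refl])
    then show ?thesis using orbits_nxt by (simp add: circuit_faces_def)
  qed
  moreover have "face_of rv (rot_of t) ` (rv ` E) = (\<lambda>A. rv ` A) ` (orbit (nxt \<circ> t) ` E)"
    unfolding image_image using face_of_rv by (rule image_cong[OF refl])
  ultimately show ?thesis unfolding faces_def arcs_eq(1) image_Un by simp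
qed

lemma orbit_in_E: "a \<in> E \<Longrightarrow> orbit (nxt \<circ> t) a \<subseteq> E" "a \<in> E \<Longrightarrow> orbit (nxt \<circ> t) a \<noteq> {}"
  using permutes_orbit_subset[OF f_permutes] orbit.base[of "nxt \<circ> t" a] by blast+

lemma other_faces_not_circuit:
  assumes "a \<in> E"
  shows "rv ` orbit (nxt \<circ> t) a \<notin> circuit_faces"
proof
  assume "rv ` orbit (nxt \<circ> t) a \<in> circuit_faces"
  then obtain c where "c \<in> C" "rv ` orbit (nxt \<circ> t) a = set (rep c)" by (auto simp: circuit_faces_def)
  then have "rv ` orbit (nxt \<circ> t) a \<subseteq> E" by (auto simp: E_def)
  then show False using orbit_in_E[OF assms] rv_not_E by blast
qed

lemma card_other_faces: "card (faces G rv (rot_of t) - circuit_faces) = card (orbit (nxt \<circ> t) ` E)"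
proof -
  have "faces G rv (rot_of t) - circuit_faces = (\<lambda>A. rv ` A) ` (orbit (nxt \<circ> t) ` E)"
    unfolding faces_rot_of using other_faces_not_circuit by blast
  moreover have "inj (\<lambda>A. rv ` A)" using arev_eq_iff by (simp add: inj_image_eq_iff inj_def)
  ultimately show ?thesis by (metis card_image inj_on_subset subset_UNIV)
qed

lemma card_faces: "card (faces G rv (rot_of t)) = card C + card (orbit (nxt \<circ> t) ` E)"
proof -
  have "circuit_faces \<subseteq> faces G rv (rot_of t)" unfolding faces_rot_of by blast
  moreover have "finite circuit_faces" using finite_C by (simp add: circuit_faces_def)
  moreover have "finite (faces G rv (rot_of t))" by (simp add: faces_def)
  moreover have "card circuit_faces = card C"
    unfolding circuit_faces_def by (rule card_image[OF inj_rep])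
  ultimately show ?thesis using card_other_faces card_Diff_subset card_mono
    by (metis le_add_diff_inverse)
qed

lemma circuit_faces_color: "face_color_class G rv (rot_of t) circuit_faces"
proof -
  have E: "face_of rv (rot_of t) a \<in> circuit_faces" if a: "a \<in> E" for a
  proof -
    obtain c where "c \<in> C" "a \<in> set (rep c)" using a by (auto simp: E_def)
    then show ?thesis using face_of_E by (simp add: circuit_faces_def)
  qed
  have rvE: "face_of rv (rot_of t) (rv a) \<notin> circuit_faces" if "a \<in> E" for a
    using face_of_rv[OF that] other_faces_not_circuit[OF that] by simp
  have "(face_of rv (rot_of t) a \<in> circuit_faces) \<noteq> (face_of rv (rot_of t) (rv a) \<in> circuit_faces)"
    if "a \<in> arcs G" for a
    using arcs_cases[OF that] E rvE arev_arev by metis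
  then show ?thesis unfolding face_color_class_def faces_rot_of by blast
qed

text \<open>Tracing the face from any of its arcs produces a cyclic shift of \<open>rep c\<close>,
  and shifts have the same class.\<close>

lemma boundary_rep:
  assumes c: "c \<in> C"
  shows "boundary_walk rv (rot_of t) (set (rep c)) = c"
proof -
  let ?f = "face_succ rv (rot_of t)"
  have p: "?f permutes arcs G" unfolding face_succ_def
    by (rule permutes_compose[OF arev_permutes_arcs rot_of_permutes])
  have cyc: "cyc ?f (rep c)"
    by (rule cyc_cong[OF nxt(2)[OF c]]) (use c in \<open>auto simp: E_def intro!: rot_of_simps(3)\<close>)
  have "walk_class rv (support ?f a) = c" if a: "a \<in> set (rep c)" for a
  proof -
    obtain A B where AB: "rep c = A @ a # B" using a by (auto dest: split_list)
    have 1: "cyc ?f ((a # B) @ A)" using cyc_rotate[of ?f A "a # B"] cyc AB by simp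
    have 2: "cyc ?f (support ?f a)" using cyc_support(1)[OF p] by simp
    then have "support ?f a \<noteq> []" by (simp add: cyc_def)
    then have "hd (support ?f a) = a" by (simp add: hd_map)
    then have "support ?f a = (a # B) @ A" using cyc_unique[OF 2 1] by simp
    then have "support ?f a \<in> rotations (rep c)" unfolding rotations_def AB by blast
    then show ?thesis using walk_class_rotate rep(2)[OF c] by metis
  qed
  moreover have "set (rep c) \<noteq> {}" using rep_nonempty[OF c] by simp
  ultimately show ?thesis unfolding boundary_walk_def by auto
qed

lemma boundary_bij: "bij_betw (boundary_walk rv (rot_of t)) circuit_faces C"
  by (rule bij_betw_byWitness[of _ "\<lambda>c. set (rep c)"]) (auto simp: circuit_faces_def boundary_rep)

text \<open>The sign is multiplicative. On E, the cycles of \<open>nxt\<close> are the circuits, and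
  those of t correspond to the vertices.\<close>

lemma parity_orbits:
  "even (card (orbit (nxt \<circ> t) ` E)) \<longleftrightarrow> even (card (verts G) + card E + card C)"
proof -
  have "orbit t ` E = inE ` verts G"
  proof
    have *: "orbit t e = inE v" if "v \<in> verts G" "e \<in> inE v" for e v
      using t orbit_cyc that unfolding rotation_def by metis
    show "orbit t ` E \<subseteq> inE ` verts G"
    proof
      fix A assume "A \<in> orbit t ` E"
      then obtain e where e: "e \<in> E" "A = orbit t e" by blast
      then have "e \<in> inE (head G e)" by (simp add: inE_def)
      then show "A \<in> inE ` verts G" using * head_E e by blast
    qed
    show "inE ` verts G \<subseteq> orbit t ` E"
    proof
      fix A assume "A \<in> inE ` verts G"
      then obtain v where v: "v \<in> verts G" "A = inE v" by blast
      then obtain e where "e \<in> inE v" using inE_nonempty by blast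
      then show "A \<in> orbit t ` E" using * v by (auto simp: inE_def)
    qed
  qed
  moreover have "inj_on inE (verts G)"
  proof (rule inj_onI)
    fix u v assume "u \<in> verts G" "v \<in> verts G" "inE u = inE v"
    then show "u = v" using inE_nonempty[of u] by (auto simp: inE_def)
  qed
  ultimately have t_orb: "card (orbit t ` E) = card (verts G)" by (simp add: card_image)
  have n_orb: "card (orbit nxt ` E) = card C" unfolding orbits_nxt by (rule card_image[OF inj_rep])
  have perm: "permutation nxt" "permutation t"
    using nxt(1) t_permutes finite_E by (auto simp: permutation_permutes)
  have "evenperm (nxt \<circ> t) \<longleftrightarrow> (evenperm nxt \<longleftrightarrow> evenperm t)"
    using evenperm_comp[OF perm] .
  then show ?thesis
    unfolding evenperm_iff_orbits[OF f_permutes finite_E] evenperm_iff_orbits[OF nxt(1) finite_E]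
      evenperm_iff_orbits[OF t_permutes finite_E] t_orb n_orb
    by (auto simp: even_add)
qed

end

text \<open>Signs are compared again, now on all arcs, whose number is even: s has one cycle for
  each vertex, \<open>rv\<close> one for each edge, and \<open>s \<circ> rv\<close> one for each
  face. This is the evenness of the Euler characteristic.\<close>

lemma faces_parity:
  assumes s: "orientable_embedding G s"
  shows "even (card (faces G rv s)) \<longleftrightarrow> even (card (verts G) + card E)"
proof -
  have sp: "s permutes arcs G" and sc: "\<And>v. v \<in> verts G \<Longrightarrow> cyclic_on s (out_arcs G v)"
    using s no_isolated unfolding orientable_embedding_def by blast+
  have orb: "orbit s a = out_arcs G v" if "v \<in> verts G" "a \<in> out_arcs G v" for v a
    using orbit_cyclic_eq3[OF sc[OF that(1)] that(2)] .
  have "orbit s ` arcs G = out_arcs G ` verts G"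
  proof
    show "orbit s ` arcs G \<subseteq> out_arcs G ` verts G"
    proof
      fix A assume "A \<in> orbit s ` arcs G"
      then obtain a where a: "a \<in> arcs G" "A = orbit s a" by blast
      then have "a \<in> out_arcs G (tail G a)" "tail G a \<in> verts G" by auto
      then show "A \<in> out_arcs G ` verts G" using orb a by blast
    qed
    show "out_arcs G ` verts G \<subseteq> orbit s ` arcs G"
    proof
      fix A assume "A \<in> out_arcs G ` verts G"
      then obtain v where v: "v \<in> verts G" "A = out_arcs G v" by blast
      then obtain a where "a \<in> out_arcs G v" using no_isolated by blast
      then show "A \<in> orbit s ` arcs G" using orb v by (metis image_eqI in_out_arcs_conv)
    qed
  qed
  moreover have "inj_on (out_arcs G) (verts G)"
  proof (rule inj_onI)
    fix u v assume uv: "u \<in> verts G" "v \<in> verts G" "out_arcs G u = out_arcs G v"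
    then obtain a where "a \<in> out_arcs G u" "a \<in> out_arcs G v" using no_isolated by blast
    then show "u = v" by simp
  qed
  ultimately have s_orb: "card (orbit s ` arcs G) = card (verts G)" by (simp add: card_image)
  have "orbit rv a = {a, rv a}" for a
  proof
    have "x \<in> {a, rv a}" if "x \<in> orbit rv a" for x using that by induction auto
    then show "orbit rv a \<subseteq> {a, rv a}" by blast
    show "{a, rv a} \<subseteq> orbit rv a"
      using orbit.base[of rv a] orbit.step[of "rv a" rv a] by simp
  qed
  then have "orbit rv ` arcs G = edges G rv" by (simp add: edges_def)
  then have r_orb: "card (orbit rv ` arcs G) = card E" using card_edges by simp
  have f: "s \<circ> rv permutes arcs G" by (rule permutes_compose[OF arev_permutes_arcs sp])
  have fo: "orbit (s \<circ> rv) ` arcs G = faces G rv s"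
    by (simp add: faces_def face_of_def[abs_def] face_succ_def)
  have "permutation s" "permutation rv"
    unfolding permutation_permutes using sp arev_permutes_arcs finite_arcs by blast+
  then have "evenperm (s \<circ> rv) \<longleftrightarrow> (evenperm s \<longleftrightarrow> evenperm rv)"
    by (rule evenperm_comp)
  then show ?thesis
    unfolding evenperm_iff_orbits[OF f finite_arcs] evenperm_iff_orbits[OF sp finite_arcs]
      evenperm_iff_orbits[OF arev_permutes_arcs finite_arcs] s_orb r_orb fo card_arcs
    by (auto simp: even_add)
qed

text \<open>Were there no further face, the faces would be matched with the circuits, whose total
  length is \<open>card E\<close>; but the faces contain all arcs, which are twice as many.\<close>

lemma extra_face:
  assumes s: "orientable_embedding G s" and C: "C \<subseteq> boundary_walk rv s ` faces G rv s"
    and ne: "E \<noteq> {}"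
  shows "card C < card (faces G rv s)"
proof (rule ccontr)
  assume "\<not> card C < card (faces G rv s)"
  then have le: "card (faces G rv s) \<le> card C" by simp
  let ?f = "face_succ rv s"
  have f: "?f permutes arcs G"
    using permutes_compose[OF arev_permutes_arcs] s unfolding orientable_embedding_def face_succ_def by blast
  have fin: "finite (faces G rv s)" by (simp add: faces_def)
  have "\<forall>c \<in> C. \<exists>F. F \<in> faces G rv s \<and> boundary_walk rv s F = c" using C by blast
  from bchoice[OF this] obtain \<phi>
    where \<phi>: "\<And>c. c \<in> C \<Longrightarrow> \<phi> c \<in> faces G rv s \<and> boundary_walk rv s (\<phi> c) = c" by blast
  have "inj_on \<phi> C" by (rule inj_on_inverseI[of _ "boundary_walk rv s"]) (simp add: \<phi>)
  then have "card (\<phi> ` C) = card C" by (rule card_image)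
  moreover have "\<phi> ` C \<subseteq> faces G rv s" using \<phi> by blast
  ultimately have all: "\<phi> ` C = faces G rv s" using card_seteq[OF fin] le by simp
  have len: "card (\<phi> c) = length (rep c)" if c: "c \<in> C" for c
  proof -
    obtain a where a: "a \<in> arcs G" "\<phi> c = orbit ?f a" using \<phi>[OF c] by (auto simp: faces_def face_of_def)
    have sup: "cyc ?f (support ?f a)" "set (support ?f a) = orbit ?f a"
      using cyc_support[OF f finite_arcs] by blast+
    have "permutation ?f" unfolding permutation_permutes using f finite_arcs by blast
    then have "a \<in> \<phi> c" using permutation_self_in_orbit a(2) by metis
    then have "walk_class rv (support ?f a) \<subseteq> c" using \<phi>[OF c] unfolding boundary_walk_def by blast
    then have "support ?f a \<in> walk_class rv (rep c)" using walk_class_self rep(2)[OF c] by blast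
    then have "length (support ?f a) = length (rep c)" by (rule walk_class_length)
    moreover have "card (\<phi> c) = length (support ?f a)"
      using sup a(2) distinct_card[of "support ?f a"] by (simp only: cyc_def)
    ultimately show ?thesis by simp
  qed
  have "permutation ?f" unfolding permutation_permutes using f finite_arcs by blast
  then have "a \<in> face_of rv s a" for a using permutation_self_in_orbit by (simp add: face_of_def)
  then have "arcs G \<subseteq> \<Union> (\<phi> ` C)" unfolding all faces_def by blast
  moreover have "finite (\<Union> (\<phi> ` C))"
  proof -
    have "finite (orbit ?f a)" for a using cyc_support(2)[OF f finite_arcs, of a] by (metis List.finite_set)
    then show ?thesis unfolding all faces_def face_of_def by auto
  qed
  ultimately have "card (arcs G) \<le> card (\<Union> (\<phi> ` C))" by (rule card_mono[rotated])
  also have "\<dots> \<le> (\<Sum>c \<in> C. card (\<phi> c))" by (rule card_UN_le[OF finite_C])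
  also have "\<dots> = (\<Sum>c \<in> C. length (rep c))" using len by simp
  also have "\<dots> = (\<Sum>c \<in> C. card (set (rep c)))"
    by (rule sum.cong) (simp_all add: rep_distinct distinct_card)
  also have "\<dots> = card E"
    unfolding E_def by (rule card_UN_disjoint[symmetric]) (use finite_C rep_disjoint in blast)+
  finally show False using card_arcs ne finite_E by simp
qed

end

section \<open>Degree bound, choice of the embedding, and comparison of genera\<close>

theorem corollary4p4:
  fixes G :: "('v, 'e) pre_digraph" and rv :: "'e \<Rightarrow> 'e" and n :: nat
    and C :: "'e list set set"
  assumes "multigraph G rv" and "card (verts G) = n"
    and "eulerian G"
    and "real (min_degree (underlying_simple G)) \<ge> (4 * real n + 2) / 5"
    and "circuit_decomposition G rv C"
  shows "\<exists>s. orientable_embedding G s \<and>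
           (\<exists>X. face_color_class G rv s X \<and>
                bij_betw (boundary_walk rv s) X C \<and>
                card (faces G rv s - X) =
                  (if odd (card (verts G) + card (edges G rv) + card C) then 1 else 2)) \<and>
           (\<forall>s'. orientable_embedding G s' \<and> C \<subseteq> boundary_walk rv s' ` faces G rv s' \<longrightarrow>
                 genus G rv s' \<le> genus G rv s)"
proof -
  interpret fin_digraph G using assms(1) by (simp add: multigraph_def)
  define adj where "adj = (\<lambda>x y. x \<noteq> y \<and> (x, y) \<in> arcs_ends G)"
  have adj: "adj x y \<longleftrightarrow> x \<noteq> y \<and> (x, y) \<in> arcs_ends G" for x y by (simp add: adj_def)
  have adj_V: "y \<in> verts G" if "adj x y" for x y
    using that by (auto simp: adj arcs_ends_def arc_to_ends_def)
  let ?nbrs = "\<lambda>x. {y \<in> verts G. adj x y}" and ?non = "\<lambda>x. {y \<in> verts G. y \<noteq> x \<and> \<not> adj x y}"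
  have deg: "out_degree (underlying_simple G) x = card (?nbrs x)" for x
  proof -
    have "out_arcs (underlying_simple G) x = Pair x ` ?nbrs x"
      using adj_V by (auto simp: out_arcs_def underlying_simple_def adj)
    then show ?thesis by (simp add: out_degree_def card_image inj_on_def)
  qed
  have min_deg: "(4 * real n + 2) / 5 \<le> real (card (?nbrs x))" if "x \<in> verts G" for x
  proof -
    have "min_degree (underlying_simple G) \<le> out_degree (underlying_simple G) x"
      unfolding min_degree_def using that by (intro Min_le) (auto simp: underlying_simple_def)
    then have "real (min_degree (underlying_simple G)) \<le> real (card (?nbrs x))"
      unfolding deg by simp
    then show ?thesis using assms(4) by linarith
  qed
  \<comment> \<open>As n is one more than the numbers of neighbours and of non-neighbours together,
    at least (4 n + 2) / 5 neighbours leave at most (n - 7) / 5 non-neighbours.\<close>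
  have dense: "5 * card (?non x) + 7 \<le> n" if x: "x \<in> verts G" for x
  proof -
    have "verts G = insert x (?nbrs x \<union> ?non x)" using x by auto
    moreover have "x \<notin> ?nbrs x \<union> ?non x" "?nbrs x \<inter> ?non x = {}" by (auto simp: adj)
    moreover have "finite (?nbrs x)" "finite (?non x)" by simp_all
    ultimately have "card (verts G) = Suc (card (?nbrs x) + card (?non x))"
      using card_insert_disjoint[of "?nbrs x \<union> ?non x" x] card_Un_disjoint[of "?nbrs x" "?non x"] by simp
    then show ?thesis using min_deg[OF x] assms(2) by simp
  qed
  have "verts G \<noteq> {}"
    using assms(3) by (auto simp: eulerian_def connected_def strongly_connected_def)
  then obtain x0 where "x0 \<in> verts G" by blast
  then have n7: "7 \<le> n" using dense by fastforce
  define N where "N = (n - 7) div 5"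
  have N: "card (?non x) \<le> N" if "x \<in> verts G" for x
    using dense[OF that] n7 unfolding N_def by linarith
  have large: "5 * N + 7 \<le> card (verts G)" using n7 assms(2) unfolding N_def by linarith
  have no_isolated: "out_arcs G v \<noteq> {}" if v: "v \<in> verts G" for v
  proof -
    have "0 < card (?nbrs v)" using min_deg[OF v] by (cases "card (?nbrs v)") auto
    then obtain y where "adj v y" by (auto simp: card_gt_0_iff)
    then show ?thesis by (auto simp: adj arcs_ends_def arc_to_ends_def)
  qed
  interpret circuit_graph G rv C
    using assms(1,5) no_isolated by unfold_locales
  obtain t where t: "rotation t" "card (orbit (nxt \<circ> t) ` E) \<le> 2"
    using few_other_faces[OF adj N large] by blast
  let ?s = "rot_of t" and ?k = "card (orbit (nxt \<circ> t) ` E)"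
  have E_ne: "E \<noteq> {}" using inE_nonempty[OF \<open>x0 \<in> verts G\<close>] by (auto simp: inE_def)
  then have "0 < ?k" using finite_E by (simp add: card_gt_0_iff)
  then have k: "?k = (if odd (card (verts G) + card (edges G rv) + card C) then 1 else 2)"
    using t(2) parity_orbits[OF t(1)] card_edges by (auto simp: le_Suc_eq numeral_2_eq_2)
  have "genus G rv s' \<le> genus G rv ?s"
    if s': "orientable_embedding G s'" "C \<subseteq> boundary_walk rv s' ` faces G rv s'" for s'
  proof -
    have "card C < card (faces G rv s')" using extra_face[OF s' E_ne] .
    moreover have "even (card (faces G rv s')) \<longleftrightarrow> even (card C + ?k)"
      using faces_parity[OF s'(1)] faces_parity[OF rot_of_embedding[OF t(1)]] card_faces[OF t(1)] by simp
    \<comment> \<open>For k = 1 the strict inequality suffices; for k = 2 the parity excludes c +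
      1.\<close>
    moreover have "c + k \<le> f" if "c < f" "even f \<longleftrightarrow> even (c + k)" "k \<le> 2" "0 < k" for c f k :: nat
      using that by presburger
    ultimately have "card C + ?k \<le> card (faces G rv s')" using t(2) \<open>0 < ?k\<close> by blast
    then show ?thesis using card_faces[OF t(1)] by (simp add: genus_def)
  qed
  then show ?thesis
    using rot_of_embedding[OF t(1)] circuit_faces_color[OF t(1)] boundary_bij[OF t(1)]
      card_other_faces[OF t(1)] k by (intro exI[of _ ?s] conjI exI[of _ circuit_faces]) auto
qed

end
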